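(* Let $l\in\mathbb{Z}$, $l\neq0$, and let $g=h^4(t)(dt^2+dy^2)$ be an $S^1$-invariant metric on the two-dimensional torus $T^2$ with the trivial spin structure. Let $\lambda_1^2(g,l)$ be the first eigenvalue of the square of the Dirac operator on sections of $S^+$ such that the $S^1$-representation $\Sigma(l)$ occurs in the decomposition of the eigenspace. Then the multiplicity of $\Sigma(l)$ in this eigenspace is one, and the corresponding eigenspinor does not vanish anywhere.
   Context: $T^2=\mathbb{R}^2/\mathbb{Z}^2$ with coordinates $0\le t\le1$, $0\le y\le1$; $h$ is a positive smooth $1$-periodic function of $t$. The group $S^1$ acts isometrically by translations in $y$, and hence on eigenspaces; $\Sigma(l)$ is the one-dimensional $S^1$-representation of weight $l$. The Dirac operator $D_g$ acts on $\mathbb{C}^2$-valued functions on $T^2$ (spinor fields for the trivial spin structure) by $$D_g=\frac1{h^2}\begin{pmatrix}0&i\\ i&0\end{pmatrix}\partial_t+\frac{h'}{h^3}\begin{pmatrix}0&i\\ i&0\end{pmatrix}+\frac1{h^2}\begin{pmatrix}0&-1\\ 1&0\end{pmatrix}\partial_y .$$ $D_g^2$ preserves the splitting $S=S^+\oplus S^-$ of the spinor bundle and has the same eigenvalues on both parts; eigenspaces of $D_g^2$ are always taken in the space of sections of $S^+$. A section of $S^+$ of weight $l$ is given by a function $A(t)e^{2\pi i l y}$, and it is an eigenspinor of $D_g^2$ with eigenvalue $\lambda^2$ iff $A$ is a nontrivial $1$-periodic solution of $$-A''(t)=\Bigl\{\lambda^2 h^4(t)+\frac{h(t)h''(t)-2(h'(t))^2}{h^2(t)}-4\pi^2l^2+4\pi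 l\,\frac{h'(t)}{h(t)}\Bigr\}A(t).$$ (With the matrix formula above, this corresponds to taking $S^+$ to be given by the second component.) "First" means smallest. *)

theory Defs
  imports "HOL-Analysis.Analysis" "HOL-Library.Function_Algebras"
begin

primrec C_n :: "nat \<Rightarrow> ('a::real_normed_vector \<Rightarrow> 'b::real_normed_vector) \<Rightarrow> bool" where
  "C_n 0 f \<longleftrightarrow> continuous_on UNIV f"
| "C_n (Suc n) f \<longleftrightarrow>
     (\<forall>x. f differentiable (at x)) \<and> (\<forall>v. C_n n (\<lambda>x. frechet_derivative f (at x) v))"

definition smooth :: "('a::real_normed_vector \<Rightarrow> 'b::real_normed_vector) \<Rightarrow> bool" where
  "smooth f \<longleftrightarrow> (\<forall>n. C_n n f)"

text \<open>The positive smooth 1-periodic functions \<open>h\<close> encode the metrics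
  \<open>g = h(t)^4 (dt^2 + dy^2)\<close>; the metric enters below only through \<open>h\<close>.\<close>

definition conformal_factor :: "(real \<Rightarrow> real) \<Rightarrow> bool" where
  "conformal_factor h \<longleftrightarrow> smooth h \<and> (\<forall>t. 0 < h t) \<and> (\<forall>t. h (t + 1) = h t)"

text \<open>Spinor fields for the trivial spin structure are functions of \<open>(t, y)\<close> on the plane
  which are 1-periodic in both variables.\<close>

type_synonym spinor = "real \<times> real \<Rightarrow> complex ^ 2"

definition spinor_field :: "spinor \<Rightarrow> bool" where
  "spinor_field \<psi> \<longleftrightarrow>
     smooth \<psi> \<and> (\<forall>t y. \<psi> (t + 1, y) = \<psi> (t, y)) \<and> (\<forall>t y. \<psi> (t, y + 1) = \<psi> (t, y))"

definition sections_plus :: "spinor set" where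
  "sections_plus = {\<psi>. spinor_field \<psi> \<and> (\<forall>p. \<psi> p $ 1 = 0)}"

definition partial_t :: "spinor \<Rightarrow> spinor" where
  "partial_t \<psi> p = frechet_derivative \<psi> (at p) (1, 0)"

definition partial_y :: "spinor \<Rightarrow> spinor" where
  "partial_y \<psi> p = frechet_derivative \<psi> (at p) (0, 1)"

definition E_t :: "complex ^ 2 ^ 2" where
  "E_t = vector [vector [0, \<i>], vector [\<i>, 0]]"

definition E_y :: "complex ^ 2 ^ 2" where
  "E_y = vector [vector [0, -1], vector [1, 0]]"

definition dirac :: "(real \<Rightarrow> real) \<Rightarrow> spinor \<Rightarrow> spinor" where
  "dirac h \<psi> = (\<lambda>(t, y).
       (1 / h t ^ 2) *\<^sub>R (E_t *v partial_t \<psi> (t, y))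
     + (deriv h t / h t ^ 3) *\<^sub>R (E_t *v \<psi> (t, y))
     + (1 / h t ^ 2) *\<^sub>R (E_y *v partial_y \<psi> (t, y)))"

text \<open>The eigenspace of the square of the Dirac operator in the sections of \<open>S\<^sup>+\<close>; it is zero
  unless \<open>\<mu>\<close> is an eigenvalue.\<close>

definition eigenspace_plus :: "(real \<Rightarrow> real) \<Rightarrow> real \<Rightarrow> spinor set" where
  "eigenspace_plus h \<mu> =
     {\<psi> \<in> sections_plus. dirac h (dirac h \<psi>) = (\<lambda>p. \<mu> *\<^sub>R \<psi> p)}"

definition spinor_scale :: "complex \<Rightarrow> spinor \<Rightarrow> spinor" where
  "spinor_scale c \<psi> = (\<lambda>p. c *s \<psi> p)"

global_interpretation spinor: vector_space spinor_scale
  by unfold_locales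
    (auto simp: spinor_scale_def fun_eq_iff vec_eq_iff algebra_simps)

text \<open>The action of \<open>exp (2 \<pi> \<i> s)\<close> in \<open>S\<^sup>1\<close>.  The sign is chosen such that
  \<open>A(t) exp (2 \<pi> \<i> l y)\<close> has weight \<open>l\<close>.\<close>

definition translate :: "real \<Rightarrow> spinor \<Rightarrow> spinor" where
  "translate s \<psi> = (\<lambda>(t, y). \<psi> (t, y + s))"

text \<open>The isotypic component of the one-dimensional representation \<open>\<Sigma>(l)\<close> in an invariant
  subspace \<open>V\<close>.  As \<open>\<Sigma>(l)\<close> is one-dimensional, its multiplicity in \<open>V\<close> is the complex
  dimension of this component.\<close>

definition isotypic :: "int \<Rightarrow> spinor set \<Rightarrow> spinor set" where
  "isotypic l V =
     {\<psi> \<in> V. \<forall>s. translate s \<psi> = spinor_scale (exp (2 * pi * \<i> * of_int l * of_real s)) \<psi>}"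

definition occurs :: "int \<Rightarrow> spinor set \<Rightarrow> bool" where
  "occurs l V \<longleftrightarrow> (\<exists>\<psi> \<in> isotypic l V. \<psi> \<noteq> 0)"

definition weight_multiplicity :: "int \<Rightarrow> spinor set \<Rightarrow> nat" where
  "weight_multiplicity l V = spinor.dim (isotypic l V)"

definition is_first_eigenvalue :: "(real \<Rightarrow> real) \<Rightarrow> int \<Rightarrow> real \<Rightarrow> bool" where
  "is_first_eigenvalue h l \<mu> \<longleftrightarrow>
     occurs l (eigenspace_plus h \<mu>) \<and> (\<forall>\<nu>. occurs l (eigenspace_plus h \<nu>) \<longrightarrow> \<mu> \<le> \<nu>)"

end

theory Submission
  imports Defs
begin

text \<open>On weight \<open>l\<close> the eigenvalue equation is a real trace-free 2x2 system with 1-periodic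
  coefficients, so \<open>\<nu>\<close> is an eigenvalue iff the monodromy has trace 2; at \<open>\<nu> = 0\<close> the trace is
  \<open>2 cosh (2 \<pi> l) > 2\<close>.  Suppose a nontrivial real periodic solution at \<open>\<mu>\<close> vanishes at \<open>s\<close>.  Then it also
  vanishes inside \<open>(s, s + 1)\<close>, since otherwise the trace at \<open>\<mu>\<close> would be negative.  Decrease the
  parameter until the solution vanishing at \<open>s\<close> has its first zero exactly at \<open>s + 1\<close>; there the
  monodromy has negative eigenvalues.  By the intermediate value theorem the trace equals 2 at
  some smaller parameter, so \<open>\<mu>\<close> is not the first eigenvalue.  Applied to real and imaginary parts,
  this shows that complex solutions do not vanish either, and a suitable combination of two
  solutions vanishes at a point, so the multiplicity is one.\<close>

section \<open>Linear systems depending on a parameter\<close>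

text \<open>The system is trace-free, so the monodromy has determinant 1, and trace 2 means
  eigenvalue 1. If the solution vanishing at \<open>s\<close> also vanishes at \<open>s + 1\<close>,
  the monodromy is triangular with reciprocal diagonal entries. One of them is, up to a positive
  factor, the slope of that solution at \<open>s + 1\<close>; at a first zero this is negative, so
  both entries are. Decreasing the parameter means minimising \<nu> over a compact set of zeros
  (\<nu>, t). The minimum is attained only at \<open>s + 1\<close>: interior zeros are simple by the
  Wronskian and persist for slightly smaller \<nu>, and none can enter through \<open>s\<close>,
  where the slope is positive uniformly in \<nu>. This requires solutions jointly continuous in
  (\<nu>, t). A gauge makes the system off-diagonal, and the solutions become power series in \<nu>
  with iterated integrals as coefficients.\<close>

lemma ex_antiderivative_real:
  fixes g :: "real \<Rightarrow> real"
  assumes "continuous_on UNIV g"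
  shows "\<exists>G. G 0 = 0 \<and> (\<forall>t. (G has_real_derivative g t) (at t))"
proof -
  have "\<exists>F. \<forall>x::real. (-\<infinity>::ereal) < x \<longrightarrow> x < (\<infinity>::ereal) \<longrightarrow> (F has_vector_derivative g x) (at x)"
    by (rule einterval_antiderivative)
      (use assms in \<open>auto simp: continuous_on_eq_continuous_at\<close>)
  then obtain F where F: "\<And>x. (F has_real_derivative g x) (at x)"
    by (auto simp: has_real_derivative_iff_has_vector_derivative)
  have "((\<lambda>t. F t - F 0) has_real_derivative g t) (at t)" for t
    using DERIV_diff[OF F DERIV_const] by simp
  then show ?thesis
    by (intro exI[of _ "\<lambda>t. F t - F 0"]) auto
qed

text \<open>For continuous \<open>g\<close> this stands for the integral from 0 to \<open>t\<close>,
  with \<open>t\<close> of either sign.\<close>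

definition antiderivative :: "(real \<Rightarrow> real) \<Rightarrow> real \<Rightarrow> real" where
  "antiderivative g = (SOME G. G 0 = 0 \<and> (\<forall>t. (G has_real_derivative g t) (at t)))"

lemma antiderivative:
  assumes "continuous_on UNIV g"
  shows antiderivative_0: "antiderivative g 0 = 0"
    and has_real_derivative_antiderivative: "(antiderivative g has_real_derivative g t) (at t)"
  using someI_ex[OF ex_antiderivative_real[OF assms]] unfolding antiderivative_def by blast+

text \<open>Subtracting \<open>f\<close> from, or adding it to, \<open>D * s ^ Suc k / Suc k\<close>
  gives a nondecreasing function that vanishes at 0.\<close>

lemma abs_le_power_of_deriv_le_nonneg:
  fixes f f' :: "real \<Rightarrow> real"
  assumes "f 0 = 0" "0 \<le> t"
    and d: "\<And>s. 0 \<le> s \<Longrightarrow> s \<le> t \<Longrightarrow> (f has_real_derivative f' s) (at s)"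
    and b: "\<And>s. 0 \<le> s \<Longrightarrow> s \<le> t \<Longrightarrow> \<bar>f' s\<bar> \<le> D * s ^ k"
  shows "\<bar>f t\<bar> \<le> D * t ^ Suc k / Suc k"
proof -
  have pw: "((\<lambda>s. D * s ^ Suc k / Suc k) has_real_derivative D * s ^ k) (at s)" for s
    by (rule derivative_eq_intros refl | simp)+
  have "(\<lambda>s. D * s ^ Suc k / Suc k - f s) 0 \<le> (\<lambda>s. D * s ^ Suc k / Suc k - f s) t"
    by (rule DERIV_nonneg_imp_nondecreasing[OF assms(2)])
      (use DERIV_diff[OF pw d] b in \<open>fastforce simp: abs_le_iff\<close>)
  moreover have "(\<lambda>s. D * s ^ Suc k / Suc k + f s) 0 \<le> (\<lambda>s. D * s ^ Suc k / Suc k + f s) t"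
    by (rule DERIV_nonneg_imp_nondecreasing[OF assms(2)])
      (use DERIV_add[OF pw d] b in \<open>fastforce simp: abs_le_iff\<close>)
  ultimately show ?thesis using assms(1) by simp
qed

lemma abs_le_power_of_deriv_le:
  fixes f f' :: "real \<Rightarrow> real"
  assumes "f 0 = 0" 
    and d: "\<And>s. (f has_real_derivative f' s) (at s)"
    and b: "\<And>s. \<bar>s\<bar> \<le> \<bar>t\<bar> \<Longrightarrow> \<bar>f' s\<bar> \<le> D * \<bar>s\<bar> ^ k"
  shows "\<bar>f t\<bar> \<le> D * \<bar>t\<bar> ^ Suc k / Suc k"
proof (cases "0 \<le> t")
  case True
  then show ?thesis
    using abs_le_power_of_deriv_le_nonneg[of f t f' D k, OF assms(1) True d] b
    by (metis abs_of_nonneg)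
next
  case False
  \<comment> \<open>Negative times reduce to positive ones by reflecting \<open>f\<close>.\<close>
  have "((\<lambda>s. f (- s)) has_real_derivative - f' (- s)) (at s)" for s
    using DERIV_mirror d by blast
  then have "\<bar>f (- (- t))\<bar> \<le> D * (- t) ^ Suc k / Suc k"
  proof (rule abs_le_power_of_deriv_le_nonneg[rotated 2])
    show "\<bar>- f' (- s)\<bar> \<le> D * s ^ k" if "0 \<le> s" "s \<le> - t" for s
      using b[of "- s"] that by simp
  qed (use False assms(1) in simp_all)
  then show ?thesis using False by (simp only: minus_minus abs_of_neg not_le)
qed

text \<open>The terms of the Picard iteration for p' = a q, q' = - \<nu> b p, stripped of their
  powers of - \<nu>: starting from the constant 1, integrate alternately against \<open>a\<close>
  and \<open>b\<close>, beginning with \<open>a\<close>.\<close>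

primrec iterated_integral :: "(real \<Rightarrow> real) \<Rightarrow> (real \<Rightarrow> real) \<Rightarrow> nat \<Rightarrow> real \<Rightarrow> real" where
  "iterated_integral a b 0 = (\<lambda>_. 1)"
| "iterated_integral a b (Suc k) =
     antiderivative (\<lambda>t. (if even k then a t else b t) * iterated_integral a b k t)"

section \<open>Growth of the iterated integrals and power series in the parameter\<close>

context
  fixes a b :: "real \<Rightarrow> real"
  assumes a: "continuous_on UNIV a" and b: "continuous_on UNIV b"
begin

lemma continuous_iterated_integral: "continuous_on UNIV (iterated_integral a b k)"
proof (induction k)
  case (Suc k)
  have "continuous_on UNIV (\<lambda>t. (if even k then a t else b t) * iterated_integral a b k t)"
    using a b Suc by (cases "even k") (auto intro!: continuous_intros)
  from has_real_derivative_antiderivative[OF this] show ?case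
    by (auto simp: continuous_on_eq_continuous_at intro: DERIV_isCont)
qed auto

lemma iterated_integral_Suc:
  shows "iterated_integral a b (Suc k) 0 = 0"
    and "(iterated_integral a b (Suc k) has_real_derivative
      (if even k then a t else b t) * iterated_integral a b k t) (at t)"
proof -
  have "continuous_on UNIV (\<lambda>t. (if even k then a t else b t) * iterated_integral a b k t)"
    using a b continuous_iterated_integral[of k] by (cases "even k") (auto intro!: continuous_intros)
  from antiderivative[OF this] 
  show "iterated_integral a b (Suc k) 0 = 0"
    and "(iterated_integral a b (Suc k) has_real_derivative
      (if even k then a t else b t) * iterated_integral a b k t) (at t)" by auto
qed

text \<open>Each integration contributes a factor \<open>C * \<bar>t\<bar>\<close> and, from
  integrating a power, a divisor \<open>Suc k\<close>; hence the factorial.\<close>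

lemma abs_iterated_integral_le:
  assumes "\<And>s. \<bar>s\<bar> \<le> R \<Longrightarrow> \<bar>a s\<bar> \<le> C \<and> \<bar>b s\<bar> \<le> C" and "\<bar>t\<bar> \<le> R"
  shows "\<bar>iterated_integral a b k t\<bar> \<le> (C * \<bar>t\<bar>) ^ k / fact k"
  using assms(2)
proof (induction k arbitrary: t)
  case (Suc k)
  have "\<bar>iterated_integral a b (Suc k) t\<bar> \<le> (C ^ Suc k / fact k) * \<bar>t\<bar> ^ Suc k / Suc k"
  proof (rule abs_le_power_of_deriv_le[OF iterated_integral_Suc])
    fix s :: real assume s: "\<bar>s\<bar> \<le> \<bar>t\<bar>"
    with Suc.prems have "\<bar>s\<bar> \<le> R" by simp
    have "\<bar>if even k then a s else b s\<bar> * \<bar>iterated_integral a b k s\<bar> \<le> C * ((C * \<bar>s\<bar>) ^ k / fact k)"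
      using assms(1)[OF \<open>\<bar>s\<bar> \<le> R\<close>] Suc.IH[OF \<open>\<bar>s\<bar> \<le> R\<close>]
      by (intro mult_mono) auto
    then show "\<bar>(if even k then a s else b s) * iterated_integral a b k s\<bar> \<le> C ^ Suc k / fact k * \<bar>s\<bar> ^ k"
      by (simp only: abs_mult) (simp add: power_mult_distrib mult_ac)
  qed
  then show ?case by (simp add: power_mult_distrib field_simps)
qed auto

text \<open>\<open>a\<close> and \<open>b\<close> are bounded on the compact interval, so one
  constant serves all \<open>k\<close> and all \<open>t\<close> in it.\<close>

lemma iterated_integral_bound:
  "\<exists>C\<ge>0. (\<forall>t. \<bar>t\<bar> \<le> R \<longrightarrow> \<bar>a t\<bar> \<le> C \<and> \<bar>b t\<bar> \<le> C) \<and>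
    (\<forall>k t. \<bar>t\<bar> \<le> R \<longrightarrow> \<bar>iterated_integral a b k t\<bar> \<le> (C * R) ^ k / fact k)"
proof -
  have "compact (a ` {-R..R} \<union> b ` {-R..R})"
    using a b by (intro compact_Un compact_continuous_image) (auto intro: continuous_on_subset)
  then obtain C where C: "\<And>x. x \<in> a ` {-R..R} \<union> b ` {-R..R} \<Longrightarrow> \<bar>x\<bar> \<le> C"
    using compact_imp_bounded[THEN bounded_iff[THEN iffD1]] by (metis real_norm_def)
  have C': "\<bar>a s\<bar> \<le> \<bar>C\<bar> \<and> \<bar>b s\<bar> \<le> \<bar>C\<bar>" if "\<bar>s\<bar> \<le> R" for s
    using C[of "a s"] C[of "b s"] that by fastforce
  have "\<bar>iterated_integral a b k t\<bar> \<le> (\<bar>C\<bar> * R) ^ k / fact k" if "\<bar>t\<bar> \<le> R" for k t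
  proof -
    have "(\<bar>C\<bar> * \<bar>t\<bar>) ^ k / fact k \<le> (\<bar>C\<bar> * R) ^ k / fact k"
      using that by (intro divide_right_mono power_mono mult_left_mono) auto
    then show ?thesis using abs_iterated_integral_le[OF C' that, of k] by linarith
  qed
  then show ?thesis using C' by (intro exI[of _ "\<bar>C\<bar>"]) auto
qed

text \<open>The coefficients \<open>s k\<close> will be 0 or powers of - \<nu>. Allowing one factor
  \<open>max 1 \<bar>\<nu>\<bar>\<close> per integration still leaves the factorial in
  control.\<close>

context
  fixes s :: "nat \<Rightarrow> real \<Rightarrow> real"
  assumes s_le: "\<And>k \<nu>. \<bar>s k \<nu>\<bar> \<le> (max 1 \<bar>\<nu>\<bar>) ^ k"
    and s_cont: "\<And>k. continuous_on UNIV (s k)"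
begin

text \<open>A Weierstrass majorant on a box in (\<nu>, t): the exponential series at
  \<open>max 1 N * (C * R)\<close>.\<close>

lemma iterated_integral_series_bound:
  obtains M where "summable M"
    "\<And>k \<nu> t. \<bar>\<nu>\<bar> \<le> N \<Longrightarrow> \<bar>t\<bar> \<le> R \<Longrightarrow> \<bar>s k \<nu> * iterated_integral a b k t\<bar> \<le> M k"
proof -
  obtain C where C: "0 \<le> C"
    "\<And>k t. \<bar>t\<bar> \<le> R \<Longrightarrow> \<bar>iterated_integral a b k t\<bar> \<le> (C * R) ^ k / fact k"
    using iterated_integral_bound[of R] by blast
  define M where "M k = (max 1 N * (C * R)) ^ k /\<^sub>R fact k" for k :: nat
  have "summable M" unfolding M_def by (rule summable_exp_generic)
  moreover have "\<bar>s k \<nu> * iterated_integral a b k t\<bar> \<le> M k" if "\<bar>\<nu>\<bar> \<le> N" "\<bar>t\<bar> \<le> R" for k \<nu> t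
  proof -
    have "\<bar>s k \<nu>\<bar> \<le> (max 1 N) ^ k"
      using s_le[of k \<nu>] that power_mono[of "max 1 \<bar>\<nu>\<bar>" "max 1 N" k] by linarith
    then have "\<bar>s k \<nu>\<bar> * \<bar>iterated_integral a b k t\<bar> \<le> (max 1 N) ^ k * ((C * R) ^ k / fact k)"
      using C(2)[OF that(2)] by (intro mult_mono) auto
    then show ?thesis by (simp add: M_def abs_mult power_mult_distrib field_simps)
  qed
  ultimately show ?thesis using that by blast
qed

lemma summable_iterated_integral_series: "summable (\<lambda>k. s k \<nu> * iterated_integral a b k t)"
proof -
  obtain M where M: "summable M"
    "\<And>k \<nu>' t'. \<bar>\<nu>'\<bar> \<le> \<bar>\<nu>\<bar> \<Longrightarrow> \<bar>t'\<bar> \<le> \<bar>t\<bar> \<Longrightarrow> \<bar>s k \<nu>' * iterated_integral a b k t'\<bar> \<le> M k"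
    using iterated_integral_series_bound[of "\<bar>\<nu>\<bar>" "\<bar>t\<bar>"] by auto
  show ?thesis
    by (rule summable_comparison_test[OF _ M(1)]) (use M(2) in auto)
qed

text \<open>On each box the partial sums converge uniformly. Continuity is local, and every point is
  interior to some box.\<close>

lemma continuous_iterated_integral_series:
  "continuous_on UNIV (\<lambda>(\<nu>, t). \<Sum>k. s k \<nu> * iterated_integral a b k t)"
proof -
  have box: "continuous_on ({-N..N} \<times> {-N..N}) (\<lambda>(\<nu>, t). \<Sum>k. s k \<nu> * iterated_integral a b k t)" for N
  proof -
    obtain M where M: "summable M"
      "\<And>k \<nu> t. \<bar>\<nu>\<bar> \<le> N \<Longrightarrow> \<bar>t\<bar> \<le> N \<Longrightarrow> \<bar>s k \<nu> * iterated_integral a b k t\<bar> \<le> M k"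
      using iterated_integral_series_bound[of N N] by auto
    have "uniform_limit ({-N..N} \<times> {-N..N}) 
        (\<lambda>n x. \<Sum>k<n. s k (fst x) * iterated_integral a b k (snd x))
        (\<lambda>x. \<Sum>k. s k (fst x) * iterated_integral a b k (snd x)) sequentially"
      by (rule Weierstrass_m_test[OF _ M(1)]) (use M(2) in auto)
    moreover have "continuous_on X (\<lambda>x. \<Sum>k<n. s k (fst x) * iterated_integral a b k (snd x))" for X n
      by (intro continuous_intros continuous_on_compose2[OF s_cont]
          continuous_on_compose2[OF continuous_iterated_integral]) auto
    ultimately show ?thesis
      unfolding case_prod_beta by (intro uniform_limit_theorem[where F = sequentially]) auto
  qed
  show ?thesis
    unfolding continuous_on_eq_continuous_at[OF open_UNIV]
  proof
    fix x :: "real \<times> real"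
    define N where "N = \<bar>fst x\<bar> + \<bar>snd x\<bar> + 1"
    have "x \<in> interior ({-N..N} \<times> {-N..N})" by (cases x) (auto simp: N_def interior_Times)
    then show "isCont (\<lambda>(\<nu>, t). \<Sum>k. s k \<nu> * iterated_integral a b k t) x"
      using continuous_on_interior[OF box] by blast
  qed
qed

end

text \<open>Termwise differentiation: the term of index \<open>Suc k\<close> gives back the integral
  of index \<open>k\<close>, so the differentiated series again has an exponential majorant.\<close>

lemma has_derivative_iterated_integral_series:
  assumes s_le: "\<And>k. \<bar>s k\<bar> \<le> (max 1 \<bar>\<nu>\<bar>) ^ k"
  shows "((\<lambda>t. \<Sum>k. s k * iterated_integral a b k t) has_real_derivative
    (\<Sum>k. s (Suc k) * ((if even k then a t else b t) * iterated_integral a b k t))) (at t)"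
proof -
  define R where "R = \<bar>t\<bar> + 1"
  obtain C where C: "0 \<le> C" "\<And>t. \<bar>t\<bar> \<le> R \<Longrightarrow> \<bar>a t\<bar> \<le> C \<and> \<bar>b t\<bar> \<le> C"
    "\<And>k t. \<bar>t\<bar> \<le> R \<Longrightarrow> \<bar>iterated_integral a b k t\<bar> \<le> (C * R) ^ k / fact k"
    using iterated_integral_bound[of R] by blast
  define N where "N = max 1 \<bar>\<nu>\<bar>"
  define f' where "f' n x = (case n of 0 \<Rightarrow> 0
    | Suc k \<Rightarrow> s (Suc k) * ((if even k then a x else b x) * iterated_integral a b k x))" for n x
  define M where "M n = (case n of 0 \<Rightarrow> 0 | Suc k \<Rightarrow> N * C * ((N * (C * R)) ^ k /\<^sub>R fact k))" for n
  have "summable (\<lambda>k. N * C * ((N * (C * R)) ^ k /\<^sub>R fact k))"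
    by (intro summable_mult summable_exp_generic)
  then have "summable (\<lambda>k. M (Suc k))" unfolding M_def nat.case .
  then have M: "summable M" by (rule summable_Suc_iff[THEN iffD1, of M])
  have fM: "\<bar>f' n x\<bar> \<le> M n" if "\<bar>x\<bar> \<le> R" for n x
  proof (cases n)
    case (Suc k)
    have "\<bar>s (Suc k)\<bar> * (\<bar>if even k then a x else b x\<bar> * \<bar>iterated_integral a b k x\<bar>)
      \<le> N ^ Suc k * (C * ((C * R) ^ k / fact k))"
    proof (intro mult_mono)
      show "\<bar>s (Suc k)\<bar> \<le> N ^ Suc k" using s_le[of "Suc k"] unfolding N_def .
      show "\<bar>if even k then a x else b x\<bar> \<le> C" using C(2)[OF that] by presburger
    qed (use C(1) C(3)[OF that] in \<open>auto simp: N_def\<close>)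
    also have "\<dots> = N * C * ((N * (C * R)) ^ k /\<^sub>R fact k)"
      by (simp add: power_mult_distrib field_simps)
    finally show ?thesis
      unfolding f'_def M_def Suc nat.case abs_mult .
  qed (simp add: f'_def M_def)
  have "((\<lambda>t. \<Sum>k. s k * iterated_integral a b k t) has_real_derivative (\<Sum>n. f' n t)) (at t)"
  proof (rule has_field_derivative_series'(2))
    show "convex {-R..R}" by simp
    have "- R < t" "t < R" "0 \<le> R" unfolding R_def by linarith+
    then show "0 \<in> {-R..R}" "t \<in> interior {-R..R}" by simp_all
    show "((\<lambda>t. s n * iterated_integral a b n t) has_real_derivative f' n x) (at x within {-R..R})" for n x
    proof (cases n)
      case (Suc k)
      show ?thesis
        unfolding Suc f'_def nat.case
        by (intro DERIV_cmult has_field_derivative_at_within[OF iterated_integral_Suc(2)])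
    qed (simp add: f'_def)
    show "uniformly_convergent_on {-R..R} (\<lambda>n x. \<Sum>i<n. f' i x)"
      by (rule Weierstrass_m_test'[OF _ M]) (use fM in auto)
    \<comment> \<open>Only the term of index 0 survives at time 0; this is the one point of
      convergence that termwise differentiation asks for.\<close>
    have "s n * iterated_integral a b n 0 = 0" if "n \<notin> {0}" for n
      using that iterated_integral_Suc(1) by (cases n) auto
    then show "summable (\<lambda>n. s n * iterated_integral a b n 0)"
      by (intro summable_finite[of "{0}"]) auto
  qed
  moreover have "summable (\<lambda>n. f' n t)"
    by (rule summable_comparison_test[OF _ M]) (use fM[of t] in \<open>auto simp: R_def\<close>)
  then have "(\<Sum>n. f' n t) = (\<Sum>k. f' (Suc k) t)"
    by (subst suminf_split_head) (simp_all add: f'_def)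
  ultimately show ?thesis by (simp add: f'_def)
qed

end

lemma ex_parametrized_solution:
  fixes a b :: "real \<Rightarrow> real"
  assumes a: "continuous_on UNIV a" and b: "continuous_on UNIV b"
  obtains P Q :: "real \<Rightarrow> real \<Rightarrow> real" where
    "\<And>\<nu>. P \<nu> 0 = 0" "\<And>\<nu>. Q \<nu> 0 = 1"
    "\<And>\<nu> t. (P \<nu> has_real_derivative a t * Q \<nu> t) (at t)"
    "\<And>\<nu> t. (Q \<nu> has_real_derivative - \<nu> * b t * P \<nu> t) (at t)"
    "continuous_on UNIV (\<lambda>(\<nu>, t). P \<nu> t)" "continuous_on UNIV (\<lambda>(\<nu>, t). Q \<nu> t)"
proof -
  \<comment> \<open>Picard iteration from the data (0, 1) puts the odd integrals into
    \<open>P\<close> and the even ones into \<open>Q\<close>. Each integration against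
    \<open>b\<close> brings a factor - \<nu>, and there are \<open>k div 2\<close> of them.\<close>
  define p q :: "nat \<Rightarrow> real \<Rightarrow> real" where
    "p k \<nu> = (if even k then 0 else (- \<nu>) ^ (k div 2))" and
    "q k \<nu> = (if even k then (- \<nu>) ^ (k div 2) else 0)" for k \<nu>
  define P Q where "P \<nu> t = (\<Sum>k. p k \<nu> * iterated_integral a b k t)"
    and "Q \<nu> t = (\<Sum>k. q k \<nu> * iterated_integral a b k t)" for \<nu> t
  have "\<bar>\<nu>\<bar> ^ (k div 2) \<le> (max 1 \<bar>\<nu>\<bar>) ^ k" for k and \<nu> :: real
    using power_mono[of "\<bar>\<nu>\<bar>" "max 1 \<bar>\<nu>\<bar>" "k div 2"] power_increasing[of "k div 2" k "max 1 \<bar>\<nu>\<bar>"]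
    by simp
  then have p_le: "\<bar>p k \<nu>\<bar> \<le> (max 1 \<bar>\<nu>\<bar>) ^ k" and q_le: "\<bar>q k \<nu>\<bar> \<le> (max 1 \<bar>\<nu>\<bar>) ^ k" for k \<nu>
    by (auto simp: p_def q_def power_abs)
  have p_cont: "continuous_on UNIV (p k)" and q_cont: "continuous_on UNIV (q k)" for k
    by (cases "even k"; auto simp: p_def[abs_def] q_def[abs_def] intro!: continuous_intros)+
  note sum_p = summable_iterated_integral_series[OF a b p_le p_cont]
  note sum_q = summable_iterated_integral_series[OF a b q_le q_cont]
  have at_0: "(\<Sum>k. c k * iterated_integral a b k 0) = c 0" for c :: "nat \<Rightarrow> real"
  proof -
    have "c k * iterated_integral a b k 0 = 0" if "k \<notin> {0}" for k
      using that iterated_integral_Suc(1)[OF a b] by (cases k) auto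
    then show ?thesis by (subst suminf_finite[of "{0}"]) auto
  qed
  show ?thesis
  proof
    show "P \<nu> 0 = 0" "Q \<nu> 0 = 1" for \<nu>
      by (simp_all add: P_def Q_def at_0 p_def q_def)
    show "continuous_on UNIV (\<lambda>(\<nu>, t). P \<nu> t)" "continuous_on UNIV (\<lambda>(\<nu>, t). Q \<nu> t)"
      unfolding P_def Q_def
      by (rule continuous_iterated_integral_series[OF a b p_le p_cont],
          rule continuous_iterated_integral_series[OF a b q_le q_cont])
    fix \<nu> t
    have "p (Suc k) \<nu> * ((if even k then a t else b t) * iterated_integral a b k t)
        = a t * (q k \<nu> * iterated_integral a b k t)" for k
      by (simp add: p_def q_def)
    then have "(\<Sum>k. p (Suc k) \<nu> * ((if even k then a t else b t) * iterated_integral a b k t)) = a t * Q \<nu> t"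
      unfolding Q_def by (simp only: suminf_mult[OF sum_q])
    then show "(P \<nu> has_real_derivative a t * Q \<nu> t) (at t)"
      using has_derivative_iterated_integral_series[OF a b p_le, of \<nu> t]
      by (simp only: P_def[abs_def])
    have "q (Suc k) \<nu> * ((if even k then a t else b t) * iterated_integral a b k t)
        = - \<nu> * b t * (p k \<nu> * iterated_integral a b k t)" for k
      by (auto simp: p_def q_def elim!: oddE)
    then have "(\<Sum>k. q (Suc k) \<nu> * ((if even k then a t else b t) * iterated_integral a b k t)) = - \<nu> * b t * P \<nu> t"
      unfolding P_def by (simp only: suminf_mult[OF sum_p])
    then show "(Q \<nu> has_real_derivative - \<nu> * b t * P \<nu> t) (at t)"
      using has_derivative_iterated_integral_series[OF a b q_le, of \<nu> t]
      by (simp only: Q_def[abs_def])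
  qed
qed

section \<open>Spinors of a fixed weight\<close>

lemma C_n_SucI:
  assumes "\<And>x. (f has_derivative f' x) (at x)" and "\<And>v. C_n n (\<lambda>x. f' x v)"
  shows "C_n (Suc n) f"
proof -
  \<comment> \<open>Uniqueness identifies the derivative chosen in \<open>C_n\<close> with any
    explicitly known one.\<close>
  have "frechet_derivative f (at x) = f' x" for x
    using frechet_derivative_at[OF assms(1)] by simp
  then show ?thesis using assms by (auto simp: differentiable_def)
qed

lemma C_n_Suc_has_derivative:
  "C_n (Suc n) f \<Longrightarrow> (f has_derivative frechet_derivative f (at x)) (at x)"
  by (simp add: frechet_derivative_works)

text \<open>The product and inverse rules need this, because undifferentiated functions reappear in
  their derivatives.\<close>

lemma C_n_SucD: "C_n (Suc n) f \<Longrightarrow> C_n n f"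
proof (induction n arbitrary: f)
  case 0
  then show ?case
    by (auto simp: continuous_on_eq_continuous_at intro: differentiable_imp_continuous_within)
next
  case (Suc n)
  then have "C_n n (\<lambda>x. frechet_derivative f (at x) v)" for v
    by (metis C_n.simps(2))
  with Suc.prems show ?case by (metis C_n.simps(2))
qed

lemma C_n_const: "C_n n (\<lambda>_. c)"
proof (induction n arbitrary: c)
  case (Suc n)
  show ?case by (rule C_n_SucI[where f' = "\<lambda>_ _. 0"]) (auto intro!: derivative_eq_intros Suc)
qed auto

lemma C_n_bounded_linear:
  assumes "bounded_linear L" "C_n n f"
  shows "C_n n (\<lambda>x. L (f x))"
  using assms(2)
proof (induction n arbitrary: f)
  case 0
  then show ?case using assms(1) by (simp add: bounded_linear.continuous_on)
next
  case (Suc n)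
  show ?case
  proof (rule C_n_SucI)
    show "((\<lambda>x. L (f x)) has_derivative (\<lambda>v. L (frechet_derivative f (at x) v))) (at x)" for x
      by (rule bounded_linear.has_derivative[OF assms(1) C_n_Suc_has_derivative[OF Suc.prems]])
  qed (use Suc in auto)
qed

lemma C_n_compose_bounded_linear:
  assumes "bounded_linear L" "C_n n f"
  shows "C_n n (\<lambda>x. f (L x))"
  using assms(2)
proof (induction n arbitrary: f)
  case 0
  then show ?case
    using continuous_on_compose2[OF _ bounded_linear.continuous_on[OF assms(1) continuous_on_id]] by auto
next
  case (Suc n)
  show ?case
  proof (rule C_n_SucI)
    show "((\<lambda>x. f (L x)) has_derivative (\<lambda>v. frechet_derivative f (at (L x)) (L v))) (at x)" for x
      by (rule has_derivative_compose[OF bounded_linear_imp_has_derivative[OF assms(1)]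
            C_n_Suc_has_derivative[OF Suc.prems]])
  qed (use Suc in auto)
qed

lemma C_n_add: "C_n n f \<Longrightarrow> C_n n g \<Longrightarrow> C_n n (\<lambda>x. f x + g x)"
proof (induction n arbitrary: f g)
  case 0
  then show ?case by (auto intro: continuous_on_add)
next
  case (Suc n)
  show ?case
    by (rule C_n_SucI[OF has_derivative_add[OF C_n_Suc_has_derivative[OF Suc.prems(1)]
            C_n_Suc_has_derivative[OF Suc.prems(2)]]])
      (use Suc in auto)
qed

lemma C_n_mult:
  fixes f g :: "'a::real_normed_vector \<Rightarrow> 'b::real_normed_algebra"
  shows "C_n n f \<Longrightarrow> C_n n g \<Longrightarrow> C_n n (\<lambda>x. f x * g x)"
proof (induction n arbitrary: f g)
  case 0
  then show ?case by (auto intro: continuous_on_mult)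
next
  case (Suc n)
  show ?case
  proof (rule C_n_SucI[OF has_derivative_mult[OF C_n_Suc_has_derivative[OF Suc.prems(1)]
            C_n_Suc_has_derivative[OF Suc.prems(2)]]])
    show "C_n n (\<lambda>x. f x * frechet_derivative g (at x) v + frechet_derivative f (at x) v * g x)" for v
      using Suc.IH C_n_SucD[OF Suc.prems(1)] C_n_SucD[OF Suc.prems(2)] Suc.prems
      by (intro C_n_add) auto
  qed
qed

lemma C_n_inverse:
  fixes f :: "'a::real_normed_vector \<Rightarrow> real"
  assumes "\<And>x. f x \<noteq> 0"
  shows "C_n n f \<Longrightarrow> C_n n (\<lambda>x. inverse (f x))"
proof (induction n)
  case 0
  then show ?case using assms by (auto intro: continuous_on_inverse)
next
  case (Suc n)
  show ?case
  proof (rule C_n_SucI[OF Deriv.has_derivative_inverse[OF assms C_n_Suc_has_derivative[OF Suc.prems]]])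
    have "C_n n (\<lambda>x. inverse (f x))" using Suc.IH C_n_SucD[OF Suc.prems] .
    then have "C_n n (\<lambda>x. (-1) * (inverse (f x) * frechet_derivative f (at x) v * inverse (f x)))" for v
      using Suc.prems by (intro C_n_mult C_n_const) auto
    then show "C_n n (\<lambda>x. - (inverse (f x) * frechet_derivative f (at x) v * inverse (f x)))" for v
      by simp
  qed
qed

lemma C_n_Suc_vector_derivativeI:
  fixes f f' :: "real \<Rightarrow> 'a::real_normed_vector"
  assumes "\<And>t. (f has_vector_derivative f' t) (at t)" "C_n n f'"
  shows "C_n (Suc n) f"
proof (rule C_n_SucI)
  show "(f has_derivative (\<lambda>v. v *\<^sub>R f' t)) (at t)" for t
    using assms(1) by (simp add: has_vector_derivative_def)
  show "C_n n (\<lambda>t. v *\<^sub>R f' t)" for v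
    by (rule C_n_bounded_linear[OF bounded_linear_scaleR_right assms(2)])
qed

text \<open>On the line a Frechet derivative is determined by its value at 1.\<close>

lemma C_n_Suc_vector_derivative:
  fixes f :: "real \<Rightarrow> 'a::real_normed_vector"
  assumes "C_n (Suc n) f"
  obtains f' where "\<And>t. (f has_vector_derivative f' t) (at t)" "C_n n f'"
proof
  show "(f has_vector_derivative frechet_derivative f (at t) 1) (at t)" for t
  proof -
    have "linear (frechet_derivative f (at t))"
      using C_n_Suc_has_derivative[OF assms] has_derivative_linear by blast
    then have "frechet_derivative f (at t) v = v *\<^sub>R frechet_derivative f (at t) 1" for v
      using linear_scale[of "frechet_derivative f (at t)" v 1] by simp
    then have "frechet_derivative f (at t) = (\<lambda>v. v *\<^sub>R frechet_derivative f (at t) 1)"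
      by (rule ext)
    then show ?thesis
      using C_n_Suc_has_derivative[OF assms, of t] unfolding has_vector_derivative_def by metis
  qed
  show "C_n n (\<lambda>t. frechet_derivative f (at t) 1)" using assms by simp
qed

section \<open>Characters, and the Dirac operator on weight spinors\<close>

definition character :: "int \<Rightarrow> real \<Rightarrow> complex" where
  "character l y = exp (2 * pi * \<i> * of_int l * of_real y)"

lemma has_vector_derivative_character:
  "(character l has_vector_derivative (2 * pi * \<i> * of_int l) * character l y) (at y)"
proof -
  have "((\<lambda>z. exp (2 * pi * \<i> * of_int l * z)) has_field_derivative
      (2 * pi * \<i> * of_int l) * character l y) (at (of_real y))"
    by (auto intro!: derivative_eq_intros simp: character_def)
  from has_vector_derivative_real_field[OF this] show ?thesis
    by (simp add: character_def[abs_def])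
qed

lemma C_n_character: "C_n n (character l)"
proof (induction n)
  case 0
  show ?case by (auto simp: character_def[abs_def] intro!: continuous_intros)
next
  case (Suc n)
  show ?case
    by (rule C_n_Suc_vector_derivativeI[OF has_vector_derivative_character]) (intro C_n_mult C_n_const Suc)
qed

lemma character_add: "character l (x + y) = character l x * character l y"
  by (simp add: character_def exp_add[symmetric] algebra_simps)

lemma character_0 [simp]: "character l 0 = 1"
  by (simp add: character_def)

lemma character_1 [simp]: "character l 1 = 1"
  using exp_integer_2pi[OF Ints_of_int, of l] by (simp add: character_def mult_ac)

lemma character_neq_0 [simp]: "character l y \<noteq> 0"
  by (simp add: character_def)

lemma bounded_linear_axis: "bounded_linear (axis k :: 'a::euclidean_space \<Rightarrow> 'a ^ 'n::finite)"
  by (subst linear_conv_bounded_linear[symmetric])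
    (auto intro!: linearI simp: axis_def vec_eq_iff)

text \<open>\<open>k = 2\<close> gives sections of S+ and \<open>k = 1\<close> sections of S-; the
  Dirac operator exchanges the two.\<close>

definition weight_spinor :: "2 \<Rightarrow> int \<Rightarrow> (real \<Rightarrow> complex) \<Rightarrow> spinor" where
  "weight_spinor k l A = (\<lambda>(t, y). axis k (A t * character l y))"

lemma has_derivative_weight_spinor:
  assumes "(A has_vector_derivative A') (at t)"
  shows "(weight_spinor k l A has_derivative (\<lambda>v. axis k
    ((fst v *\<^sub>R A' + (snd v * (2 * pi * of_int l)) *\<^sub>R (\<i> * A t)) * character l y))) (at (t, y))"
proof -
  have 1: "((\<lambda>p. A (fst p)) has_derivative (\<lambda>v. fst v *\<^sub>R A')) (at (t, y))"
    using has_derivative_compose[OF has_derivative_fst[OF has_derivative_ident]]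
      assms[unfolded has_vector_derivative_def] by fastforce
  have 2: "((\<lambda>p. character l (snd p)) has_derivative
      (\<lambda>v. snd v *\<^sub>R ((2 * pi * \<i> * of_int l) * character l y))) (at (t, y))"
    using has_derivative_compose[OF has_derivative_snd[OF has_derivative_ident]]
      has_vector_derivative_character[unfolded has_vector_derivative_def] by fastforce
  have "((\<lambda>p. axis k (A (fst p) * character l (snd p)) :: complex ^ 2) has_derivative (\<lambda>v. axis k
      (A t * (snd v *\<^sub>R ((2 * pi * \<i> * of_int l) * character l y)) + (fst v *\<^sub>R A') * character l y))) (at (t, y))"
    using bounded_linear.has_derivative[OF bounded_linear_axis has_derivative_mult[OF 1 2]] by simp
  also have "(\<lambda>v. axis k
      (A t * (snd v *\<^sub>R ((2 * pi * \<i> * of_int l) * character l y)) + (fst v *\<^sub>R A') * character l y)) =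
    (\<lambda>v. axis k
    ((fst v *\<^sub>R A' + (snd v * (2 * pi * of_int l)) *\<^sub>R (\<i> * A t)) * character l y) :: complex ^ 2)"
    by (simp add: scaleR_conv_of_real algebra_simps)
  finally show ?thesis unfolding weight_spinor_def case_prod_beta .
qed

lemma C_n_weight_spinor: "C_n n A \<Longrightarrow> C_n n (weight_spinor k l A)"
proof -
  assume "C_n n A"
  then have "C_n n (\<lambda>p::real \<times> real. A (fst p))"
    by (rule C_n_compose_bounded_linear[OF bounded_linear_fst])
  moreover have "C_n n (\<lambda>p::real \<times> real. character l (snd p))"
    by (rule C_n_compose_bounded_linear[OF bounded_linear_snd C_n_character])
  ultimately have "C_n n (\<lambda>p. axis k (A (fst p) * character l (snd p)) :: complex ^ 2)"
    by (intro C_n_bounded_linear[OF bounded_linear_axis] C_n_mult)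
  then show ?thesis unfolding weight_spinor_def case_prod_beta .
qed

lemma partial_weight_spinor:
  assumes "(A has_vector_derivative A') (at t)"
  shows partial_t_weight_spinor: "partial_t (weight_spinor k l A) (t, y) = axis k (A' * character l y)"
    and partial_y_weight_spinor:
      "partial_y (weight_spinor k l A) (t, y) = axis k ((2 * pi * of_int l) *\<^sub>R (\<i> * A t) * character l y)"
  unfolding partial_t_def partial_y_def frechet_derivative_at[OF has_derivative_weight_spinor[OF assms], symmetric]
  by simp_all

lemma E_axis:
  "E_t *v axis 1 x = axis 2 (\<i> * x)" "E_t *v axis 2 x = axis 1 (\<i> * x)"
  "E_y *v axis 1 x = axis 2 x" "E_y *v axis 2 x = axis 1 (- x)"
  by (simp_all add: E_t_def E_y_def vec_eq_iff forall_2 matrix_vector_mult_def sum_2 axis_def)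

text \<open>The y-derivative contributes \<i> times a real factor, so \<i> can be pulled out and a
  real operator remains. The sign of the weight term comes from \<open>E_y\<close> and is opposite
  on S-.\<close>

lemma dirac_weight_spinor_plus:
  assumes "\<And>t. (A has_vector_derivative A' t) (at t)"
  shows "dirac h (weight_spinor 2 l A) = weight_spinor 1 l (\<lambda>t. \<i> * ((1 / h t ^ 2) *\<^sub>R (A' t - (2 * pi * of_int l) *\<^sub>R A t)
    + (deriv h t / h t ^ 3) *\<^sub>R A t))"
proof -
  have "dirac h (weight_spinor 2 l A) (t, y) = weight_spinor 1 l (\<lambda>t. \<i> * ((1 / h t ^ 2) *\<^sub>R (A' t - (2 * pi * of_int l) *\<^sub>R A t)
    + (deriv h t / h t ^ 3) *\<^sub>R A t)) (t, y)" for t y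
    unfolding dirac_def case_prod_conv partial_weight_spinor[OF assms]
    unfolding weight_spinor_def E_axis case_prod_conv
    by (simp only: vec_eq_iff forall_2 axis_def vec_lambda_beta vector_add_component vector_scaleR_component)
      (simp add: scaleR_conv_of_real algebra_simps)
  then show ?thesis by (simp add: fun_eq_iff)
qed

lemma dirac_weight_spinor_minus:
  assumes "\<And>t. (A has_vector_derivative A' t) (at t)"
  shows "dirac h (weight_spinor 1 l A) = weight_spinor 2 l (\<lambda>t. \<i> * ((1 / h t ^ 2) *\<^sub>R (A' t + (2 * pi * of_int l) *\<^sub>R A t)
    + (deriv h t / h t ^ 3) *\<^sub>R A t))"
proof -
  have "dirac h (weight_spinor 1 l A) (t, y) = weight_spinor 2 l (\<lambda>t. \<i> * ((1 / h t ^ 2) *\<^sub>R (A' t + (2 * pi * of_int l) *\<^sub>R A t)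
    + (deriv h t / h t ^ 3) *\<^sub>R A t)) (t, y)" for t y
    unfolding dirac_def case_prod_conv partial_weight_spinor[OF assms]
    unfolding weight_spinor_def E_axis case_prod_conv
    by (simp only: vec_eq_iff forall_2 axis_def vec_lambda_beta vector_add_component vector_scaleR_component)
      (simp add: scaleR_conv_of_real algebra_simps)
  then show ?thesis by (simp add: fun_eq_iff)
qed

text \<open>For a section \<open>(0, A(t) exp (2 \<pi> \<i> l y))\<close> put \<open>u = h A\<close>, and let \<open>\<i> w / h\<close> be the coefficient of
  its image under \<open>D\<close>.  Then \<open>D\<^sup>2 = \<nu>\<close> becomes a real first order system of trace zero, free of \<open>h'\<close>.\<close>

definition dirac_system ::
    "(real \<Rightarrow> real) \<Rightarrow> int \<Rightarrow> real \<Rightarrow> (real \<Rightarrow> 'a::real_normed_vector) \<Rightarrow> (real \<Rightarrow> 'a) \<Rightarrow> bool" where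
  "dirac_system h l \<nu> u w \<longleftrightarrow>
     (\<forall>t. (u has_vector_derivative ((2 * pi * of_int l) *\<^sub>R u t + h t ^ 2 *\<^sub>R w t)) (at t)) \<and>
     (\<forall>t. (w has_vector_derivative (- ((2 * pi * of_int l) *\<^sub>R w t) - (\<nu> * h t ^ 2) *\<^sub>R u t)) (at t))"

definition periodic_dirac_system ::
    "(real \<Rightarrow> real) \<Rightarrow> int \<Rightarrow> real \<Rightarrow> (real \<Rightarrow> 'a::real_normed_vector) \<Rightarrow> (real \<Rightarrow> 'a) \<Rightarrow> bool" where
  "periodic_dirac_system h l \<nu> u w \<longleftrightarrow>
     dirac_system h l \<nu> u w \<and> (\<forall>t. u (t + 1) = u t) \<and> (\<forall>t. w (t + 1) = w t)"

lemma has_vector_derivative_shift: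
  assumes "(f has_vector_derivative f') (at (t + c :: real))"
  shows "((\<lambda>t. f (t + c)) has_vector_derivative f') (at t)"
proof -
  have "((\<lambda>t. t + c) has_real_derivative 1) (at t)"
    by (auto intro!: derivative_eq_intros)
  from vector_diff_chain_at[OF this[unfolded has_real_derivative_iff_has_vector_derivative] assms]
  show ?thesis by (simp add: o_def)
qed

lemma periodic_vector_derivative:
  fixes f :: "real \<Rightarrow> 'a::real_normed_vector"
  assumes "\<And>t. (f has_vector_derivative f' t) (at t)" "\<And>t. f (t + 1) = f t"
  shows "f' (t + 1) = f' t"
  using has_vector_derivative_shift[OF assms(1)[of "t + 1"]] assms(1)[of t]
  unfolding assms(2) by (rule vector_derivative_unique_at)

section \<open>Eigenspinors of weight \<open>l\<close> and periodic solutions of the system\<close>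

context
  fixes h :: "real \<Rightarrow> real"
  assumes h: "conformal_factor h"
begin

lemma conformal_factor_pos: "0 < h t"
  using h by (simp add: conformal_factor_def)

lemma conformal_factor_periodic: "h (t + 1) = h t"
  using h by (simp add: conformal_factor_def)

lemma C_n_conformal_factor: "C_n n h"
  using h by (simp add: conformal_factor_def smooth_def)

lemma has_real_derivative_conformal_factor: "(h has_real_derivative deriv h t) (at t)"
proof -
  obtain h' where "\<And>t. (h has_vector_derivative h' t) (at t)"
    using C_n_Suc_vector_derivative[of 0 h, OF C_n_conformal_factor] by metis
  then show ?thesis
    by (metis DERIV_imp_deriv has_real_derivative_iff_has_vector_derivative)
qed

text \<open>The first application of \<open>dirac\<close> brings \<open>deriv h\<close> into the
  coefficient, and the second one differentiates it.\<close>

lemma has_vector_derivative_deriv_conformal_factor: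
  obtains h'' where "\<And>t. (deriv h has_vector_derivative h'' t) (at t)"
proof -
  obtain h' where h': "\<And>t. (h has_vector_derivative h' t) (at t)" "C_n (Suc 0) h'"
    using C_n_Suc_vector_derivative[of "Suc 0" h, OF C_n_conformal_factor] by metis
  have "h' = deriv h"
    using h'(1) by (metis DERIV_imp_deriv has_real_derivative_iff_has_vector_derivative ext)
  then show ?thesis
    using that C_n_Suc_vector_derivative[of 0 h', OF h'(2)] unfolding \<open>h' = deriv h\<close> by metis
qed

text \<open>Bootstrap: if \<open>u\<close> and \<open>w\<close> are \<open>C_n n\<close>, so are the
  right-hand sides of the system, hence the derivatives.\<close>

lemma C_n_dirac_system:
  fixes u w :: "real \<Rightarrow> real"
  assumes "dirac_system h l \<nu> u w"
  shows "C_n n u \<and> C_n n w"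
proof (induction n)
  case 0
  then show ?case
    using assms unfolding dirac_system_def
    by (auto simp: continuous_on_eq_continuous_at intro: has_vector_derivative_continuous)
next
  case (Suc n)
  have h2: "C_n n (\<lambda>t. h t ^ 2)"
    unfolding power2_eq_square by (intro C_n_mult C_n_conformal_factor)
  have "C_n n (\<lambda>t. (2 * pi * of_int l) * u t + h t ^ 2 * w t)"
    using Suc h2 by (intro C_n_add C_n_mult C_n_const) auto
  moreover have "C_n n (\<lambda>t. (- (2 * pi * of_int l)) * w t + (- \<nu> * h t ^ 2) * u t)"
    using Suc h2 by (intro C_n_add C_n_mult C_n_const) auto
  ultimately show ?case
    using assms unfolding dirac_system_def real_scaleR_def
    by (auto intro!: C_n_Suc_vector_derivativeI[of u "\<lambda>t. (2 * pi * of_int l) * u t + h t ^ 2 * w t"]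
        C_n_Suc_vector_derivativeI[of w "\<lambda>t. - (2 * pi * of_int l * w t) - \<nu> * h t ^ 2 * u t"] simp del: C_n.simps)
qed

text \<open>Differentiating \<open>1 / h\<close> produces a \<open>deriv h\<close> term that cancels
  the zeroth order term of \<open>dirac\<close>. Thus u / h goes to \<i> w / h, and this to \<nu> u
  / h.\<close>

lemma dirac_system_dirac_squared:
  fixes u w :: "real \<Rightarrow> complex"
  assumes "dirac_system h l \<nu> u w"
  shows "dirac h (dirac h (weight_spinor 2 l (\<lambda>t. (1 / h t) *\<^sub>R u t))) =
    (\<lambda>p. \<nu> *\<^sub>R weight_spinor 2 l (\<lambda>t. (1 / h t) *\<^sub>R u t) p)"
proof -
  let ?m = "2 * pi * of_int l :: real"
  note h_neq_0 = conformal_factor_pos[THEN less_imp_neq, THEN not_sym]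
  have h': "((\<lambda>t. 1 / h t) has_real_derivative - deriv h t / h t ^ 2) (at t)" for t
    using has_real_derivative_conformal_factor[of t] h_neq_0[of t]
    by (auto intro!: derivative_eq_intros simp: power2_eq_square)
  have A': "((\<lambda>t. (1 / h t) *\<^sub>R u t) has_vector_derivative
      (1 / h t) *\<^sub>R (?m *\<^sub>R u t + h t ^ 2 *\<^sub>R w t) + (- deriv h t / h t ^ 2) *\<^sub>R u t) (at t)" for t
    using assms unfolding dirac_system_def
    by (intro has_vector_derivative_scaleR h') auto
  have B': "((\<lambda>t. \<i> * ((1 / h t) *\<^sub>R w t)) has_vector_derivative \<i> * (
      (1 / h t) *\<^sub>R (- (?m *\<^sub>R w t) - (\<nu> * h t ^ 2) *\<^sub>R u t) + (- deriv h t / h t ^ 2) *\<^sub>R w t)) (at t)" for t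
    using assms unfolding dirac_system_def
    by (intro has_vector_derivative_mult_right has_vector_derivative_scaleR h') auto
  have "dirac h (weight_spinor 2 l (\<lambda>t. (1 / h t) *\<^sub>R u t)) = weight_spinor 1 l (\<lambda>t. \<i> * ((1 / h t) *\<^sub>R w t))"
    unfolding dirac_weight_spinor_plus[OF A']
    using h_neq_0 by (intro arg_cong[of _ _ "weight_spinor 1 l"])
      (auto simp: fun_eq_iff scaleR_conv_of_real field_simps power2_eq_square power3_eq_cube)
  then have "dirac h (dirac h (weight_spinor 2 l (\<lambda>t. (1 / h t) *\<^sub>R u t))) =
      dirac h (weight_spinor 1 l (\<lambda>t. \<i> * ((1 / h t) *\<^sub>R w t)))"
    by simp
  also have "\<dots> = weight_spinor 2 l (\<lambda>t. \<nu> *\<^sub>R ((1 / h t) *\<^sub>R u t))"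
    unfolding dirac_weight_spinor_minus[OF B']
    using h_neq_0 by (intro arg_cong[of _ _ "weight_spinor 2 l"])
      (auto simp: fun_eq_iff scaleR_conv_of_real field_simps power2_eq_square power3_eq_cube)
  finally show ?thesis
    by (auto simp: weight_spinor_def axis_def vec_eq_iff fun_eq_iff)
qed

text \<open>Used at parameters below \<mu>: a real periodic solution there yields an eigenspinor,
  against minimality.\<close>

lemma periodic_dirac_system_imp_isotypic:
  fixes u w :: "real \<Rightarrow> real"
  assumes "periodic_dirac_system h l \<nu> u w"
  shows "weight_spinor 2 l (\<lambda>t. (1 / h t) *\<^sub>R of_real (u t)) \<in> isotypic l (eigenspace_plus h \<nu>)"
    (is "?\<psi> \<in> _")
proof -
  have sys: "dirac_system h l \<nu> u w" and per: "\<And>t. u (t + 1) = u t"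
    using assms by (auto simp: periodic_dirac_system_def)
  have "dirac_system h l \<nu> (\<lambda>t. of_real (u t) :: complex) (\<lambda>t. of_real (w t))"
    using sys has_vector_derivative_of_real unfolding dirac_system_def
    by (fastforce simp: scaleR_conv_of_real has_real_derivative_iff_has_vector_derivative)
  note D2 = dirac_system_dirac_squared[OF this]
  have "C_n n (\<lambda>t. (1 / h t) *\<^sub>R of_real (u t) :: complex)" for n
  proof -
    have "C_n n (\<lambda>t. inverse (h t) * u t)"
      using C_n_dirac_system[OF sys, of n] conformal_factor_pos
      by (intro C_n_mult C_n_inverse C_n_conformal_factor) (auto simp: less_imp_neq[THEN not_sym])
    then have "C_n n (\<lambda>t. of_real (inverse (h t) * u t) :: complex)"
      by (rule C_n_bounded_linear[OF bounded_linear_of_real])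
    then show ?thesis by (simp add: scaleR_conv_of_real divide_inverse)
  qed
  then have "smooth ?\<psi>" by (auto simp: smooth_def intro: C_n_weight_spinor)
  then have "spinor_field ?\<psi>"
    by (auto simp: spinor_field_def weight_spinor_def per conformal_factor_periodic character_add)
  moreover have "translate s ?\<psi> = spinor_scale (exp (2 * pi * \<i> * of_int l * of_real s)) ?\<psi>" for s
    unfolding character_def[symmetric]
    by (auto simp: translate_def spinor_scale_def weight_spinor_def character_add axis_def
        vec_eq_iff fun_eq_iff)
  ultimately show ?thesis
    using D2 by (auto simp: isotypic_def eigenspace_plus_def sections_plus_def weight_spinor_def axis_def)
qed

lemma isotypic_eigenspace_plusE:
  assumes "\<psi> \<in> isotypic l (eigenspace_plus h \<nu>)"
  obtains u w :: "real \<Rightarrow> complex" where "periodic_dirac_system h l \<nu> u w"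
    "\<psi> = weight_spinor 2 l (\<lambda>t. (1 / h t) *\<^sub>R u t)"
proof -
  let ?m = "2 * pi * of_int l :: real"
  note h_neq_0 = conformal_factor_pos[THEN less_imp_neq, THEN not_sym]
  define A where "A t = \<psi> (t, 0) $ 2" for t
  have \<psi>: "smooth \<psi>" "\<And>t y. \<psi> (t + 1, y) = \<psi> (t, y)" "\<And>p. \<psi> p $ 1 = 0"
    "dirac h (dirac h \<psi>) = (\<lambda>p. \<nu> *\<^sub>R \<psi> p)"
    "\<And>s. translate s \<psi> = spinor_scale (character l s) \<psi>"
    using assms by (auto simp: isotypic_def eigenspace_plus_def sections_plus_def spinor_field_def character_def)
  \<comment> \<open>Equivariance evaluated at \<open>y = 0\<close> separates the variables.\<close>
  have "\<psi> (t, y) = axis 2 (A t * character l y)" for t y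
    using fun_cong[OF \<psi>(5)[of y], of "(t, 0)"] \<psi>(3)
    by (auto simp: translate_def spinor_scale_def A_def vec_eq_iff forall_2 axis_def)
  then have \<psi>A: "\<psi> = weight_spinor 2 l A" by (auto simp: weight_spinor_def)
  have bl: "bounded_linear (\<lambda>t::real. (t, 0::real))"
    by (intro bounded_linear_Pair bounded_linear_ident bounded_linear_zero)
  have "C_n n A" for n
    unfolding A_def using \<psi>(1)
    by (intro C_n_bounded_linear[OF bounded_linear_vec_nth] C_n_compose_bounded_linear[OF bl])
      (simp add: smooth_def)
  then obtain A' where A': "\<And>t. (A has_vector_derivative A' t) (at t)" "C_n (Suc 0) A'"
    using C_n_Suc_vector_derivative[of "Suc 0" A] by metis
  then obtain A'' where A'': "\<And>t. (A' has_vector_derivative A'' t) (at t)"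
    using C_n_Suc_vector_derivative[of 0 A', OF A'(2)] by metis
  obtain h'' where h'': "\<And>t. (deriv h has_vector_derivative h'' t) (at t)"
    using has_vector_derivative_deriv_conformal_factor by metis
  note h' = has_real_derivative_conformal_factor
  define B where "B t = \<i> * ((1 / h t ^ 2) *\<^sub>R (A' t - ?m *\<^sub>R A t) + (deriv h t / h t ^ 3) *\<^sub>R A t)" for t
  \<comment> \<open>Only the existence of \<open>B'\<close> is extracted; its value is read off from
    the eigenvalue equation in \<open>B_eq\<close>.\<close>
  obtain B' where B': "\<And>t. (B has_vector_derivative B' t) (at t)"
  proof -
    have 1: "((\<lambda>t. 1 / h t ^ 2) has_real_derivative (- (2 * h t * deriv h t) / h t ^ 4)) (at t)" for t
      using h_neq_0[of t] by (auto intro!: derivative_eq_intros h' simp: power2_eq_square power4_eq_xxxx)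
    have 2: "((\<lambda>t. deriv h t / h t ^ 3) has_real_derivative
        (h'' t * h t ^ 3 - deriv h t * (3 * h t ^ 2 * deriv h t)) / (h t ^ 3 * h t ^ 3)) (at t)" for t
      using h_neq_0[of t] h''[of t, folded has_real_derivative_iff_has_vector_derivative]
      by (auto intro!: derivative_eq_intros h')
    have "((\<lambda>t. ?m *\<^sub>R A t) has_vector_derivative ?m *\<^sub>R A' t) (at t)" for t
      by (rule bounded_linear.has_vector_derivative[OF bounded_linear_scaleR_right A'(1)])
    note 3 = has_vector_derivative_scaleR[OF 1 has_vector_derivative_diff[OF A'' this]]
    note 4 = has_vector_derivative_mult_right[OF
        has_vector_derivative_add[OF 3 has_vector_derivative_scaleR[OF 2 A'(1)]], of "\<i>"]
    have "\<exists>D. (B has_vector_derivative D) (at t)" for t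
      unfolding B_def[abs_def] using 4 by (rule exI)
    then show ?thesis using that by metis
  qed
  have dirac_A: "dirac h \<psi> = weight_spinor 1 l B"
    unfolding \<psi>A dirac_weight_spinor_plus[OF A'(1)] B_def[abs_def] ..
  have B_eq: "\<i> * ((1 / h t ^ 2) *\<^sub>R (B' t + ?m *\<^sub>R B t) + (deriv h t / h t ^ 3) *\<^sub>R B t) = \<nu> *\<^sub>R A t" for t
    using arg_cong[OF fun_cong[OF \<psi>(4)[unfolded dirac_A dirac_weight_spinor_minus[OF B']], of "(t, 0)"],
        of "\<lambda>v. v $ 2"]
    unfolding \<psi>A by (simp add: weight_spinor_def)
  \<comment> \<open>Solves A = u / h and B = \<i> w / h for \<open>u\<close> and
    \<open>w\<close>.\<close>
  define u w where "u t = h t *\<^sub>R A t" and "w t = - \<i> * h t *\<^sub>R B t" for t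
  have "(u has_vector_derivative (?m *\<^sub>R u t + h t ^ 2 *\<^sub>R w t)) (at t)" for t
  proof -
    have "(u has_vector_derivative (h t *\<^sub>R A' t + deriv h t *\<^sub>R A t)) (at t)"
      unfolding u_def[abs_def] by (intro has_vector_derivative_scaleR h' A')
    moreover have "h t *\<^sub>R A' t + deriv h t *\<^sub>R A t = ?m *\<^sub>R u t + h t ^ 2 *\<^sub>R w t"
      using h_neq_0[of t] by (simp add: u_def w_def B_def scaleR_conv_of_real field_simps power2_eq_square power3_eq_cube)
    ultimately show ?thesis by simp
  qed
  moreover have "(w has_vector_derivative (- (?m *\<^sub>R w t) - (\<nu> * h t ^ 2) *\<^sub>R u t)) (at t)" for t
  proof -
    have "(w has_vector_derivative - \<i> * (h t *\<^sub>R B' t + deriv h t *\<^sub>R B t)) (at t)"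
      unfolding w_def[abs_def] by (intro has_vector_derivative_mult_right has_vector_derivative_scaleR h' B')
    moreover have "- \<i> * (h t *\<^sub>R B' t + deriv h t *\<^sub>R B t) = - (?m *\<^sub>R w t) - (\<nu> * h t ^ 2) *\<^sub>R u t"
    proof -
      have "(\<nu> * h t ^ 2) *\<^sub>R u t = h t ^ 3 *\<^sub>R (\<nu> *\<^sub>R A t)"
        by (simp add: u_def power2_eq_square power3_eq_cube)
      also have "\<dots> = h t *\<^sub>R (\<i> * (B' t + ?m *\<^sub>R B t)) + deriv h t *\<^sub>R (\<i> * B t)"
        unfolding B_eq[symmetric] using h_neq_0[of t]
        by (simp add: scaleR_conv_of_real field_simps power2_eq_square power3_eq_cube)
      finally show ?thesis by (simp add: w_def scaleR_conv_of_real algebra_simps)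
    qed
    ultimately show ?thesis by simp
  qed
  ultimately have sys: "dirac_system h l \<nu> u w" by (simp add: dirac_system_def)
  have u_per: "u (t + 1) = u t" for t
    using \<psi>(2) by (simp add: u_def A_def conformal_factor_periodic)
  \<comment> \<open>Periodicity passes from \<open>u\<close> to \<open>w\<close>, because h^2 w is
    u' minus a constant multiple of \<open>u\<close>.\<close>
  have "w (t + 1) = w t" for t
    using periodic_vector_derivative[OF sys[unfolded dirac_system_def, THEN conjunct1, rule_format] u_per, of t]
      h_neq_0[of t] by (simp add: u_per conformal_factor_periodic)
  moreover have "\<psi> = weight_spinor 2 l (\<lambda>t. (1 / h t) *\<^sub>R u t)"
    using h_neq_0 by (simp add: \<psi>A u_def)
  ultimately show ?thesis
    using that[of u w] sys u_per by (simp add: periodic_dirac_system_def)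
qed

end

section \<open>The periodic problem\<close>

lemma dirac_system_linear_combination:
  fixes u1 w1 u2 w2 :: "real \<Rightarrow> 'a::real_normed_algebra"
  assumes "dirac_system h l \<nu> u1 w1" "dirac_system h l \<nu> u2 w2"
  shows "dirac_system h l \<nu> (\<lambda>t. c * u1 t + d * u2 t) (\<lambda>t. c * w1 t + d * w2 t)"
proof -
  have u: "((\<lambda>t. c * u1 t + d * u2 t) has_vector_derivative
      c * ((2 * pi * of_int l) *\<^sub>R u1 t + h t ^ 2 *\<^sub>R w1 t) + d * ((2 * pi * of_int l) *\<^sub>R u2 t + h t ^ 2 *\<^sub>R w2 t)) (at t)" for t
    using assms unfolding dirac_system_def
    by (intro has_vector_derivative_add has_vector_derivative_mult_right) auto
  have w: "((\<lambda>t. c * w1 t + d * w2 t) has_vector_derivative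
      c * (- ((2 * pi * of_int l) *\<^sub>R w1 t) - (\<nu> * h t ^ 2) *\<^sub>R u1 t) + d * (- ((2 * pi * of_int l) *\<^sub>R w2 t) - (\<nu> * h t ^ 2) *\<^sub>R u2 t)) (at t)" for t
    using assms unfolding dirac_system_def
    by (intro has_vector_derivative_add has_vector_derivative_mult_right) auto
  show ?thesis
    using u w unfolding dirac_system_def by (simp add: algebra_simps)
qed

text \<open>Meant for \<open>Re\<close> and \<open>Im\<close>: the coefficients are real, so both
  parts of a complex solution are solutions.\<close>

lemma dirac_system_bounded_linear:
  assumes "bounded_linear L" "dirac_system h l \<nu> u w"
  shows "dirac_system h l \<nu> (\<lambda>t. L (u t)) (\<lambda>t. L (w t))"
proof -
  interpret L: bounded_linear L by (rule assms(1))
  have "((\<lambda>t. L (u t)) has_vector_derivative L ((2 * pi * of_int l) *\<^sub>R u t + h t ^ 2 *\<^sub>R w t)) (at t)" for t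
    by (rule L.has_vector_derivative) (use assms(2) in \<open>simp add: dirac_system_def\<close>)
  moreover have "((\<lambda>t. L (w t)) has_vector_derivative
      L (- ((2 * pi * of_int l) *\<^sub>R w t) - (\<nu> * h t ^ 2) *\<^sub>R u t)) (at t)" for t
    by (rule L.has_vector_derivative) (use assms(2) in \<open>simp add: dirac_system_def\<close>)
  ultimately show ?thesis
    unfolding dirac_system_def L.add L.diff linear_neg[OF L.linear] L.scaleR by blast
qed

lemma dirac_system_shift:
  assumes "dirac_system h l \<nu> u w" "\<And>t. h (t + 1) = h t"
  shows "dirac_system h l \<nu> (\<lambda>t. u (t + 1)) (\<lambda>t. w (t + 1))"
proof -
  have "((\<lambda>t. u (t + 1)) has_vector_derivative
      (2 * pi * of_int l) *\<^sub>R u (t + 1) + h (t + 1) ^ 2 *\<^sub>R w (t + 1)) (at t)" for t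
    by (rule has_vector_derivative_shift) (use assms(1) in \<open>simp add: dirac_system_def\<close>)
  moreover have "((\<lambda>t. w (t + 1)) has_vector_derivative
      - ((2 * pi * of_int l) *\<^sub>R w (t + 1)) - (\<nu> * h (t + 1) ^ 2) *\<^sub>R u (t + 1)) (at t)" for t
    by (rule has_vector_derivative_shift) (use assms(1) in \<open>simp add: dirac_system_def\<close>)
  ultimately show ?thesis
    unfolding dirac_system_def assms(2) by blast
qed

lemma dirac_system_real:
  fixes u w :: "real \<Rightarrow> real"
  shows "dirac_system h l \<nu> u w \<longleftrightarrow>
    (\<forall>t. (u has_real_derivative 2 * pi * of_int l * u t + h t ^ 2 * w t) (at t)) \<and>
    (\<forall>t. (w has_real_derivative - (2 * pi * of_int l * w t) - \<nu> * h t ^ 2 * u t) (at t))"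
  unfolding dirac_system_def has_real_derivative_iff_has_vector_derivative by simp

lemma dirac_system_continuous:
  "dirac_system h l \<nu> u w \<Longrightarrow> continuous_on S u \<and> continuous_on S w"
  unfolding dirac_system_def
  by (auto intro!: continuous_at_imp_continuous_on intro: has_vector_derivative_continuous)

text \<open>The coefficient matrix has trace zero, so the determinant of two solutions has
  derivative zero.\<close>

lemma wronskian_constant:
  fixes u1 w1 u2 w2 :: "real \<Rightarrow> real"
  assumes "dirac_system h l \<nu> u1 w1" "dirac_system h l \<nu> u2 w2"
  shows "u1 t * w2 t - u2 t * w1 t = u1 s * w2 s - u2 s * w1 s"
proof (rule DERIV_isconst_all[of "\<lambda>t. u1 t * w2 t - u2 t * w1 t"], rule allI)
  fix t
  show "((\<lambda>t. u1 t * w2 t - u2 t * w1 t) has_real_derivative 0) (at t)"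
    using assms unfolding dirac_system_real
    by (auto intro!: derivative_eq_intros simp: algebra_simps)
qed

text \<open>Cramer's rule: the Wronskians of the three pairs are constant, known from the data at
  \<open>s\<close>, and determine \<open>u t\<close> and \<open>w t\<close>.\<close>

lemma dirac_system_unique:
  fixes u w u1 w1 u2 w2 :: "real \<Rightarrow> real"
  assumes "dirac_system h l \<nu> u w" "dirac_system h l \<nu> u1 w1" "dirac_system h l \<nu> u2 w2"
    and init: "u1 s = 1" "w1 s = 0" "u2 s = 0" "w2 s = 1"
  shows "u t = u s * u1 t + w s * u2 t" "w t = u s * w1 t + w s * w2 t"
proof -
  have 1: "u t * w1 t - u1 t * w t = - w s" and 2: "u t * w2 t - u2 t * w t = u s"
    and 3: "u1 t * w2 t - u2 t * w1 t = 1"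
    using wronskian_constant[OF assms(1,2), of t s] wronskian_constant[OF assms(1,3), of t s]
      wronskian_constant[OF assms(2,3), of t s] init by simp_all
  have "u t = u t * (u1 t * w2 t - u2 t * w1 t)" by (simp add: 3)
  also have "\<dots> = (u t * w2 t - u2 t * w t) * u1 t - (u t * w1 t - u1 t * w t) * u2 t"
    by (simp add: algebra_simps)
  finally show "u t = u s * u1 t + w s * u2 t" unfolding 1 2 by simp
  have "w t = w t * (u1 t * w2 t - u2 t * w1 t)" by (simp add: 3)
  also have "\<dots> = (u t * w2 t - u2 t * w t) * w1 t - (u t * w1 t - u1 t * w t) * w2 t"
    by (simp add: algebra_simps)
  finally show "w t = u s * w1 t + w s * w2 t" unfolding 1 2 by simp
qed

text \<open>The gauge \<open>u = exp (m t) p\<close>, \<open>w = exp (- m t) q\<close> removes the diagonal terms of the system.\<close>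

lemma dirac_system_gauge:
  fixes p q h :: "real \<Rightarrow> real" and l :: int and s :: real
  defines "m \<equiv> 2 * pi * of_int l"
  assumes p: "\<And>t. (p has_real_derivative h (t + s) ^ 2 * exp (- 2 * m * t) * q t) (at t)"
    and q: "\<And>t. (q has_real_derivative - \<nu> * (h (t + s) ^ 2 * exp (2 * m * t)) * p t) (at t)"
  shows "dirac_system h l \<nu> (\<lambda>t. exp (m * (t - s)) * p (t - s)) (\<lambda>t. exp (- m * (t - s)) * q (t - s))"
proof -
  have p': "((\<lambda>t. p (t - s)) has_real_derivative h t ^ 2 * exp (- 2 * m * (t - s)) * q (t - s)) (at t)" for t
    using DERIV_shift[of p _ t "- s", THEN iffD1] p[of "t - s"] by (simp only: diff_add_cancel diff_conv_add_uminus[symmetric])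
  have q': "((\<lambda>t. q (t - s)) has_real_derivative - \<nu> * (h t ^ 2 * exp (2 * m * (t - s))) * p (t - s)) (at t)" for t
    using DERIV_shift[of q _ t "- s", THEN iffD1] q[of "t - s"] by (simp only: diff_add_cancel diff_conv_add_uminus[symmetric])
  have e: "exp (m * (t - s)) * exp (- 2 * m * (t - s)) = exp (- m * (t - s))"
    "exp (- m * (t - s)) * exp (2 * m * (t - s)) = exp (m * (t - s))" for t
    by (simp_all add: exp_add[symmetric] algebra_simps)
  have "((\<lambda>t. exp (m * (t - s)) * p (t - s)) has_real_derivative
      m * (exp (m * (t - s)) * p (t - s)) + h t ^ 2 * ((exp (m * (t - s)) * exp (- 2 * m * (t - s))) * q (t - s))) (at t)" for t
    by (auto intro!: derivative_eq_intros p' simp: algebra_simps)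
  moreover have "((\<lambda>t. exp (- m * (t - s)) * q (t - s)) has_real_derivative
      - (m * (exp (- m * (t - s)) * q (t - s))) - \<nu> * h t ^ 2 * ((exp (- m * (t - s)) * exp (2 * m * (t - s))) * p (t - s))) (at t)" for t
    by (auto intro!: derivative_eq_intros q' simp: algebra_simps)
  ultimately show ?thesis
    unfolding dirac_system_real m_def[symmetric] e by blast
qed

lemma ex_fundamental_system:
  fixes h :: "real \<Rightarrow> real" and l :: int and s :: real
  assumes h: "continuous_on UNIV h"
  obtains U1 W1 U2 W2 :: "real \<Rightarrow> real \<Rightarrow> real" where
    "\<And>\<nu>. dirac_system h l \<nu> (U1 \<nu>) (W1 \<nu>)" "\<And>\<nu>. dirac_system h l \<nu> (U2 \<nu>) (W2 \<nu>)"
    "\<And>\<nu>. U1 \<nu> s = 1" "\<And>\<nu>. W1 \<nu> s = 0" "\<And>\<nu>. U2 \<nu> s = 0" "\<And>\<nu>. W2 \<nu> s = 1"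
    "continuous_on UNIV (\<lambda>(\<nu>, t). U1 \<nu> t)" "continuous_on UNIV (\<lambda>(\<nu>, t). U2 \<nu> t)"
    "continuous_on UNIV (\<lambda>(\<nu>, t). W2 \<nu> t)"
proof -
  define m where "m = 2 * pi * of_int l"
  \<comment> \<open>The off-diagonal coefficients left by the gauge, with time measured from
    \<open>s\<close>.\<close>
  define a b where "a t = h (t + s) ^ 2 * exp (- 2 * m * t)" and "b t = h (t + s) ^ 2 * exp (2 * m * t)" for t
  have a: "continuous_on UNIV a" and b: "continuous_on UNIV b"
    unfolding a_def b_def by (intro continuous_intros continuous_on_compose2[OF h]; simp)+
  obtain P Q :: "real \<Rightarrow> real \<Rightarrow> real" where PQ: "\<And>\<nu>. P \<nu> 0 = 0" "\<And>\<nu>. Q \<nu> 0 = 1"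
    "\<And>\<nu> t. (P \<nu> has_real_derivative a t * Q \<nu> t) (at t)"
    "\<And>\<nu> t. (Q \<nu> has_real_derivative - \<nu> * b t * P \<nu> t) (at t)"
    and PQ_cont: "continuous_on UNIV (\<lambda>(\<nu>, t). P \<nu> t)" "continuous_on UNIV (\<lambda>(\<nu>, t). Q \<nu> t)"
    using ex_parametrized_solution[OF a b] by blast
  \<comment> \<open>For the data (1, 0), exchange \<open>a\<close> and \<open>b\<close>: if (P', Q')
    solves the exchanged system, then (Q', - \<nu> P') solves the original one, for \<nu> = 0 as
    well.\<close>
  obtain P' Q' :: "real \<Rightarrow> real \<Rightarrow> real" where PQ': "\<And>\<nu>. P' \<nu> 0 = 0" "\<And>\<nu>. Q' \<nu> 0 = 1"
    "\<And>\<nu> t. (P' \<nu> has_real_derivative b t * Q' \<nu> t) (at t)"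
    "\<And>\<nu> t. (Q' \<nu> has_real_derivative - \<nu> * a t * P' \<nu> t) (at t)"
    and PQ'_cont: "continuous_on UNIV (\<lambda>(\<nu>, t). P' \<nu> t)" "continuous_on UNIV (\<lambda>(\<nu>, t). Q' \<nu> t)"
    using ex_parametrized_solution[OF b a] by blast
  have shift_cont: "continuous_on UNIV (\<lambda>(\<nu>, t). exp (c * (t - s)) * F \<nu> (t - s))"
    if "continuous_on UNIV (\<lambda>(\<nu>, t). F \<nu> t)" for c :: real and F :: "real \<Rightarrow> real \<Rightarrow> real"
  proof -
    have "continuous_on UNIV (\<lambda>x. (\<lambda>(\<nu>, t). F \<nu> t) (fst x, snd x - s))"
      by (intro continuous_on_compose2[OF that] continuous_intros) auto
    then show ?thesis
      unfolding case_prod_beta fst_conv snd_conv by (intro continuous_intros)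
  qed
  show ?thesis
  proof
    show "dirac_system h l \<nu> (\<lambda>t. exp (m * (t - s)) * Q' \<nu> (t - s)) (\<lambda>t. exp (- m * (t - s)) * (- \<nu> * P' \<nu> (t - s)))" for \<nu>
      unfolding m_def
    proof (rule dirac_system_gauge[of "Q' \<nu>" h s l "\<lambda>t. - \<nu> * P' \<nu> t"], fold m_def)
      show "(Q' \<nu> has_real_derivative h (t + s) ^ 2 * exp (- 2 * m * t) * (- \<nu> * P' \<nu> t)) (at t)" for t
        using PQ'(4)[of \<nu> t] by (simp add: a_def mult_ac)
      show "((\<lambda>t. - \<nu> * P' \<nu> t) has_real_derivative - \<nu> * (h (t + s) ^ 2 * exp (2 * m * t)) * Q' \<nu> t) (at t)" for t
        using DERIV_cmult[OF PQ'(3)[of \<nu> t], of "- \<nu>"] by (simp add: b_def mult_ac)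
    qed
    show "dirac_system h l \<nu> (\<lambda>t. exp (m * (t - s)) * P \<nu> (t - s)) (\<lambda>t. exp (- m * (t - s)) * Q \<nu> (t - s))" for \<nu>
      using PQ(3,4) unfolding m_def a_def b_def by (rule dirac_system_gauge)
    show "continuous_on UNIV (\<lambda>(\<nu>, t). exp (m * (t - s)) * Q' \<nu> (t - s))"
      "continuous_on UNIV (\<lambda>(\<nu>, t). exp (m * (t - s)) * P \<nu> (t - s))"
      "continuous_on UNIV (\<lambda>(\<nu>, t). exp (- m * (t - s)) * Q \<nu> (t - s))"
      by (rule shift_cont PQ_cont PQ'_cont)+
  qed (simp_all add: PQ PQ')
qed

section \<open>Nonpositive parameters, and signs near zeros\<close>

lemma periodic_nondecreasing_deriv_eq_0:
  fixes F F' :: "real \<Rightarrow> real"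
  assumes d: "\<And>t. (F has_real_derivative F' t) (at t)" and nonneg: "\<And>t. 0 \<le> F' t"
    and per: "\<And>t. F (t + 1) = F t"
  shows "F' t = 0"
proof -
  have mono: "F x \<le> F y" if "x \<le> y" for x y
    by (rule DERIV_nonneg_imp_nondecreasing[OF that]) (use d nonneg in blast)
  \<comment> \<open>Such an \<open>x\<close> lies between \<open>t\<close> and one of
    \<open>t + 1\<close>, \<open>t - 1\<close>, where \<open>F\<close> takes equal values.\<close>
  have "F t = F x" if "\<bar>t - x\<bar> < 1" for x
    using mono[of x "t + 1"] mono[of "t - 1" x] mono[of x t] mono[of t x] per[of t] per[of "t - 1"] that
    by (cases "x \<le> t") auto
  then have "\<forall>x. \<bar>t - x\<bar> < 1 \<longrightarrow> F t = F x" by blast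
  then show ?thesis by (rule DERIV_local_const[OF d zero_less_one])
qed

text \<open>The periodic function u w has derivative h^2 (w^2 - \<nu> u^2), which is nonnegative
  here, so it is zero and \<open>w\<close> vanishes. Then u' = 2 pi l u has no periodic solution
  except 0.\<close>

lemma periodic_dirac_system_nonpos:
  fixes u w :: "real \<Rightarrow> real"
  assumes sys: "periodic_dirac_system h l \<nu> u w" and "\<nu> \<le> 0" "l \<noteq> 0"
    and h: "\<And>t. 0 < h t"
  shows "u t = 0"
proof -
  have u: "(u has_real_derivative 2 * pi * of_int l * u t + h t ^ 2 * w t) (at t)"
    and w: "(w has_real_derivative - (2 * pi * of_int l * w t) - \<nu> * h t ^ 2 * u t) (at t)"
    and per: "u (t + 1) = u t" "w (t + 1) = w t" for t
    using sys unfolding periodic_dirac_system_def dirac_system_real by auto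
  have *: "h t ^ 2 * w t ^ 2 + (- \<nu>) * (h t ^ 2 * u t ^ 2) = 0" for t
  proof (rule periodic_nondecreasing_deriv_eq_0[of "\<lambda>t. u t * w t"
        "\<lambda>t. h t ^ 2 * w t ^ 2 + (- \<nu>) * (h t ^ 2 * u t ^ 2)"])
    show "((\<lambda>t. u t * w t) has_real_derivative h t ^ 2 * w t ^ 2 + (- \<nu>) * (h t ^ 2 * u t ^ 2)) (at t)" for t
      by (auto intro!: derivative_eq_intros u w simp: algebra_simps power2_eq_square)
    show "0 \<le> h t ^ 2 * w t ^ 2 + (- \<nu>) * (h t ^ 2 * u t ^ 2)" for t
      using assms(2) by (intro add_nonneg_nonneg mult_nonneg_nonneg) auto
  qed (simp add: per)
  have "w t = 0" for t
  proof -
    have "0 \<le> (- \<nu>) * (h t ^ 2 * u t ^ 2)" using assms(2) by (intro mult_nonneg_nonneg) auto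
    then have "h t ^ 2 * w t ^ 2 \<le> 0" using *[of t] by linarith
    then show ?thesis using h[of t] by (simp add: mult_le_0_iff)
  qed
  then have u: "(u has_real_derivative 2 * pi * of_int l * u t) (at t)" for t
    using u[of t] by simp
  \<comment> \<open>The factor 2 pi l in front of u^2 makes the derivative twice a square, whatever
    the sign of \<open>l\<close>.\<close>
  have "2 * (2 * pi * of_int l * u t)\<^sup>2 = 0"
  proof (rule periodic_nondecreasing_deriv_eq_0[of "\<lambda>t. (2 * pi * of_int l) * u t ^ 2"
        "\<lambda>t. 2 * (2 * pi * of_int l * u t)\<^sup>2"])
    show "((\<lambda>t. (2 * pi * of_int l) * u t ^ 2) has_real_derivative 2 * (2 * pi * of_int l * u t)\<^sup>2) (at t)" for t
      by (auto intro!: derivative_eq_intros u simp: algebra_simps power2_eq_square)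
  qed (simp_all add: per)
  then show ?thesis using \<open>l \<noteq> 0\<close> by simp
qed

text \<open>Multiplying \<open>u r\<close> by exp (- 2 pi l r) removes the diagonal term and leaves
  a positive derivative.\<close>

lemma dirac_system_pos:
  fixes u w :: "real \<Rightarrow> real"
  assumes sys: "dirac_system h l \<nu> u w" and "u s = 0" "s < t"
    and w: "\<And>r. s \<le> r \<Longrightarrow> r \<le> t \<Longrightarrow> 0 < w r" and h: "\<And>t. 0 < h t"
  shows "0 < u t"
proof -
  define m where "m = 2 * pi * of_int l"
  have "((\<lambda>r. exp (- m * r) * u r) has_real_derivative exp (- m * r) * (h r ^ 2 * w r)) (at r)" for r
    using sys unfolding dirac_system_real m_def[symmetric]
    by (auto intro!: derivative_eq_intros simp: algebra_simps)
  then have "exp (- m * s) * u s < exp (- m * t) * u t"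
    using w h by (intro DERIV_pos_imp_increasing[OF \<open>s < t\<close>, of "\<lambda>r. exp (- m * r) * u r"])
      (metis exp_gt_zero mult_pos_pos zero_less_power)
  then show ?thesis using assms(2) by (simp add: zero_less_mult_iff)
qed

text \<open>A strict sign change between two fixed points survives a small change of the parameter,
  which lets a simple zero be continued.\<close>

lemma ex_sign_change_of_deriv_neq_0:
  fixes f :: "real \<Rightarrow> real"
  assumes "(f has_real_derivative d) (at x)" "f x = 0" "d \<noteq> 0" "0 < e"
  obtains y z where "x - e < y" "y < x" "x < z" "z < x + e" "f y * f z < 0"
proof -
  have *: "\<exists>y z. x - e < y \<and> y < x \<and> x < z \<and> z < x + e \<and> f y * f z < 0"
    if d: "(f has_real_derivative d) (at x)" "f x = 0" "0 < d" for f :: "real \<Rightarrow> real" and d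
  proof -
    obtain e1 where "0 < e1" "\<And>k. 0 < k \<Longrightarrow> k < e1 \<Longrightarrow> f x < f (x + k)"
      using DERIV_pos_inc_right[OF d(1,3)] by blast
    moreover obtain e2 where "0 < e2" "\<And>k. 0 < k \<Longrightarrow> k < e2 \<Longrightarrow> f (x - k) < f x"
      using DERIV_pos_inc_left[OF d(1,3)] by blast
    moreover define k where "k = min e (min e1 e2) / 2"
    ultimately have "f (x - k) < 0" "0 < f (x + k)" "0 < k" "k < e"
      using \<open>0 < e\<close> d(2) by auto
    then show ?thesis
      by (intro exI[of _ "x - k"] exI[of _ "x + k"]) (auto simp: mult_less_0_iff)
  qed
  show ?thesis
  proof (cases "0 < d")
    case True
    then show ?thesis using *[OF assms(1,2)] that by blast
  next
    case False
    then show ?thesis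
      using *[OF DERIV_minus[OF assms(1)]] assms(2,3) that by fastforce
  qed
qed

lemma IVT_sign_change:
  fixes f :: "real \<Rightarrow> real"
  assumes "a \<le> b" "f a * f b < 0" "continuous_on {a..b} f"
  obtains x where "a < x" "x < b" "f x = 0"
proof -
  have "\<exists>x\<ge>a. x \<le> b \<and> f x = 0"
    using IVT'[of f a 0 b] IVT2'[of f b 0 a] assms by (auto simp: mult_less_0_iff)
  then obtain x where "a \<le> x" "x \<le> b" "f x = 0" by blast
  moreover have "f a \<noteq> 0" "f b \<noteq> 0" using assms(2) by auto
  ultimately show ?thesis using that[of x] by (metis order_le_less)
qed

section \<open>Monodromy, its trace, and the zeros of the solution vanishing at
  \<open>s\<close>\<close>

locale fundamental_system =
  fixes h :: "real \<Rightarrow> real" and l :: int and s :: real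
    and U1 W1 U2 W2 :: "real \<Rightarrow> real \<Rightarrow> real"
  assumes h_pos: "\<And>t. 0 < h t" and h_periodic: "\<And>t. h (t + 1) = h t"
    and sys1: "\<And>\<nu>. dirac_system h l \<nu> (U1 \<nu>) (W1 \<nu>)"
    and sys2: "\<And>\<nu>. dirac_system h l \<nu> (U2 \<nu>) (W2 \<nu>)"
    and init: "\<And>\<nu>. U1 \<nu> s = 1" "\<And>\<nu>. W1 \<nu> s = 0" "\<And>\<nu>. U2 \<nu> s = 0" "\<And>\<nu>. W2 \<nu> s = 1"
    and cont: "continuous_on UNIV (\<lambda>(\<nu>, t). U1 \<nu> t)" "continuous_on UNIV (\<lambda>(\<nu>, t). U2 \<nu> t)"
      "continuous_on UNIV (\<lambda>(\<nu>, t). W2 \<nu> t)"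
begin

text \<open>The columns of the monodromy matrix are (U1, W1) and (U2, W2) at \<open>s + 1\<close>.
  Its determinant is 1, so the trace alone decides whether 1 is an eigenvalue.\<close>

definition monodromy_trace :: "real \<Rightarrow> real" where
  "monodromy_trace \<nu> = U1 \<nu> (s + 1) + W2 \<nu> (s + 1)"

lemma wronskian: "U1 \<nu> t * W2 \<nu> t - U2 \<nu> t * W1 \<nu> t = 1"
  using wronskian_constant[OF sys1 sys2, of \<nu> t s] by (simp add: init)

lemma continuous_parameter:
  "continuous_on UNIV (\<lambda>\<nu>. U1 \<nu> t)" "continuous_on UNIV (\<lambda>\<nu>. U2 \<nu> t)" "continuous_on UNIV (\<lambda>\<nu>. W2 \<nu> t)"
proof -
  have *: "continuous_on UNIV (\<lambda>\<nu>. F \<nu> t)" if "continuous_on UNIV (\<lambda>(\<nu>, t). F \<nu> t)"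
    for F :: "real \<Rightarrow> real \<Rightarrow> real"
    using continuous_on_compose2[OF that, of UNIV "\<lambda>\<nu>. (\<nu>, t)"] by (simp add: continuous_on_Pair)
  show "continuous_on UNIV (\<lambda>\<nu>. U1 \<nu> t)" "continuous_on UNIV (\<lambda>\<nu>. U2 \<nu> t)" "continuous_on UNIV (\<lambda>\<nu>. W2 \<nu> t)"
    by (rule *[OF cont(1)] *[OF cont(2)] *[OF cont(3)])+
qed

lemma continuous_time: "continuous_on S (U2 \<nu>)" "continuous_on S (W2 \<nu>)"
  using dirac_system_continuous[OF sys2] by blast+

lemma deriv_U2: "(U2 \<nu> has_real_derivative 2 * pi * of_int l * U2 \<nu> t + h t ^ 2 * W2 \<nu> t) (at t)"
  using sys2[of \<nu>] unfolding dirac_system_real by blast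

text \<open>With determinant 1, the characteristic polynomial of the monodromy at 1 is 2 minus the
  trace, so some nonzero initial data return to themselves.\<close>

lemma periodic_solution_if_trace_eq_2:
  assumes "monodromy_trace \<nu> = 2"
  obtains u w :: "real \<Rightarrow> real" where "periodic_dirac_system h l \<nu> u w" "u s \<noteq> 0 \<or> w s \<noteq> 0"
proof -
  define a b c d where "a = U1 \<nu> (s + 1)" and "b = U2 \<nu> (s + 1)" and "c = W1 \<nu> (s + 1)" and "d = W2 \<nu> (s + 1)"
  have det: "a * d - b * c = 1" and tr: "a + d = 2"
    using wronskian[of \<nu> "s + 1"] assms by (simp_all add: monodromy_trace_def a_def b_def c_def d_def)
  then have 0: "(a - 1) * (d - 1) = b * c" by (simp add: algebra_simps)
  obtain x y where xy: "x \<noteq> 0 \<or> y \<noteq> 0" "x * a + y * b = x" "x * c + y * d = y"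
  proof (cases "a = 1 \<and> b = 0")
    case True
    then have "d = 1" using tr by simp
    then show ?thesis using True that[of 0 1] by simp
  next
    case False
    \<comment> \<open>The pair (- b, a - 1) annihilates the first row (a - 1, b) of monodromy minus
      identity, and by singularity also the second. It is nonzero in this case.\<close>
    then show ?thesis
      using that[of "- b" "a - 1"] 0 by (auto simp: algebra_simps)
  qed
  define u w where "u t = x * U1 \<nu> t + y * U2 \<nu> t" and "w t = x * W1 \<nu> t + y * W2 \<nu> t" for t
  have sys: "dirac_system h l \<nu> u w"
    unfolding u_def[abs_def] w_def[abs_def] by (rule dirac_system_linear_combination[OF sys1 sys2])
  have 1: "u (s + 1) = u s" "w (s + 1) = w s"
    using xy by (simp_all add: u_def w_def init a_def b_def c_def d_def)
  \<comment> \<open>The shifted solution has the same data at \<open>s\<close>; uniqueness does the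
    rest.\<close>
  have "u (t + 1) = u t" "w (t + 1) = w t" for t
    using dirac_system_unique[OF dirac_system_shift[OF sys h_periodic] sys1 sys2 init, of t]
      dirac_system_unique[OF sys sys1 sys2 init, of t] 1 by simp_all
  then show ?thesis
    using that[of u w] sys xy(1) by (simp add: periodic_dirac_system_def u_def w_def init)
qed

text \<open>At \<nu> = 0 the equation for \<open>w\<close> decouples, and \<open>w = 0\<close>
  leaves a pure exponential for \<open>u\<close>. The Wronskian then gives
  \<open>W2\<close>.\<close>

lemma parameter_0: "U1 0 t = exp (2 * pi * of_int l * (t - s))" "W2 0 t = exp (- (2 * pi * of_int l * (t - s)))"
proof -
  have "dirac_system h l 0 (\<lambda>t. exp (2 * pi * of_int l * (t - s))) (\<lambda>_. 0)"
    unfolding dirac_system_real by (auto intro!: derivative_eq_intros)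
  from dirac_system_unique[OF this sys1 sys2 init, of t]
  have 1: "U1 0 t = exp (2 * pi * of_int l * (t - s))" "W1 0 t = 0" by simp_all
  then show "U1 0 t = exp (2 * pi * of_int l * (t - s))" by simp
  show "W2 0 t = exp (- (2 * pi * of_int l * (t - s)))"
    using inverse_unique[of "U1 0 t" "W2 0 t"] wronskian[of 0 t] unfolding 1 by (simp add: exp_minus)
qed

lemma trace_parameter_0:
  assumes "l \<noteq> 0"
  shows "2 < monodromy_trace 0"
proof -
  define x :: real where "x = exp (2 * pi * of_int l)"
  have "x \<noteq> 1" "0 < x" using assms by (simp_all add: x_def)
  then have "0 < (x - 1) ^ 2 / x" by simp
  also have "\<dots> = x + inverse x - 2" using \<open>0 < x\<close> by (simp add: field_simps power2_eq_square)
  finally show ?thesis by (simp add: monodromy_trace_def parameter_0 x_def exp_minus)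
qed

text \<open>The zero at \<open>s + 1\<close> makes the monodromy triangular, and \<open>U1\<close>
  and \<open>W2\<close> there have product 1. \<open>W2\<close> has the sign of the derivative of
  \<open>U2\<close>, which cannot be positive where \<open>U2\<close> comes down to 0 from positive
  values.\<close>

lemma trace_neg_at_first_zero:
  assumes "a < s + 1" "U2 \<nu> (s + 1) = 0" and pos: "\<And>t. a \<le> t \<Longrightarrow> t < s + 1 \<Longrightarrow> 0 < U2 \<nu> t"
  shows "monodromy_trace \<nu> < 0"
proof -
  have 1: "U1 \<nu> (s + 1) * W2 \<nu> (s + 1) = 1" using wronskian[of \<nu> "s + 1"] assms(2) by simp
  have "\<not> 0 < W2 \<nu> (s + 1)"
  proof
    assume "0 < W2 \<nu> (s + 1)"
    then have "0 < 2 * pi * of_int l * U2 \<nu> (s + 1) + h (s + 1) ^ 2 * W2 \<nu> (s + 1)"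
      using assms(2) h_pos[of "s + 1"] by simp
    from DERIV_pos_inc_left[OF deriv_U2 this] obtain e where
      e: "0 < e" "\<And>k. 0 < k \<Longrightarrow> k < e \<Longrightarrow> U2 \<nu> (s + 1 - k) < 0"
      using assms(2) by auto
    define k where "k = min e (s + 1 - a) / 2"
    have "0 < k" "k < e" "a \<le> s + 1 - k" using e(1) assms(1) by (auto simp: k_def min_def field_simps)
    then show False using e(2)[of k] pos[of "s + 1 - k"] by simp
  qed
  then have "W2 \<nu> (s + 1) < 0" using 1 by (metis linorder_neqE mult_zero_right zero_neq_one)
  moreover from this have "U1 \<nu> (s + 1) < 0" using 1 by (metis less_numeral_extra(1) mult_less_0_iff not_less_iff_gr_or_eq zero_less_mult_iff)
  ultimately show ?thesis by (simp add: monodromy_trace_def)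
qed

text \<open>\<open>W2\<close> is 1 at \<open>s\<close>, and uniform continuity on a compact box
  keeps it positive for a time independent of \<nu>. So no zero of \<open>U2\<close> can enter
  through \<open>s\<close>.\<close>

lemma ex_positive_initial_interval:
  obtains \<delta> where "0 < \<delta>" "\<delta> < 1"
    "\<And>\<nu> t. 0 \<le> \<nu> \<Longrightarrow> \<nu> \<le> \<mu> \<Longrightarrow> s < t \<Longrightarrow> t \<le> s + \<delta> \<Longrightarrow> 0 < U2 \<nu> t"
proof -
  have "uniformly_continuous_on ({0..\<mu>} \<times> {s..s + 1}) (\<lambda>(\<nu>, t). W2 \<nu> t)"
    by (intro compact_uniformly_continuous compact_Times compact_Icc continuous_on_subset[OF cont(3)]) simp
  then obtain d where d: "0 < d" "\<And>x x'. x \<in> {0..\<mu>} \<times> {s..s + 1} \<Longrightarrow> x' \<in> {0..\<mu>} \<times> {s..s + 1} \<Longrightarrow>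
      dist x' x < d \<Longrightarrow> dist (case_prod W2 x') (case_prod W2 x) < 1"
    unfolding uniformly_continuous_on_def by (metis zero_less_one)
  define \<delta> where "\<delta> = min d 1 / 2"
  have \<delta>: "0 < \<delta>" "\<delta> < 1" "\<delta> < d" using d(1) by (auto simp: \<delta>_def)
  have W: "0 < W2 \<nu> t" if "0 \<le> \<nu>" "\<nu> \<le> \<mu>" "s \<le> t" "t \<le> s + \<delta>" for \<nu> t
  proof -
    have "dist (case_prod W2 (\<nu>, t)) (case_prod W2 (\<nu>, s)) < 1"
      using that \<delta> by (intro d(2)) (auto simp: dist_Pair_Pair dist_real_def)
    then show ?thesis by (simp add: init dist_real_def)
  qed
  show ?thesis
  proof (rule that[OF \<delta>(1,2)])
    fix \<nu> t assume t: "0 \<le> \<nu>" "\<nu> \<le> \<mu>" "s < t" "t \<le> s + \<delta>"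
    show "0 < U2 \<nu> t"
      by (rule dirac_system_pos[OF sys2 init(3) t(3) _ h_pos]) (use W t in auto)
  qed
qed

text \<open>Minimise the parameter over the zeros of \<open>U2\<close> in a compact box. At the
  minimum an interior zero could be continued to a still smaller parameter, so only
  \<open>s + 1\<close> remains.\<close>

lemma ex_trace_neg:
  assumes "0 < \<mu>" "s < \<tau>" "\<tau> < s + 1" "U2 \<mu> \<tau> = 0"
  obtains \<nu> where "0 \<le> \<nu>" "\<nu> < \<mu>" "monodromy_trace \<nu> < 0"
proof -
  obtain \<delta> where \<delta>: "0 < \<delta>" "\<delta> < 1"
    "\<And>\<nu> t. 0 \<le> \<nu> \<Longrightarrow> \<nu> \<le> \<mu> \<Longrightarrow> s < t \<Longrightarrow> t \<le> s + \<delta> \<Longrightarrow> 0 < U2 \<nu> t"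
    using ex_positive_initial_interval by metis
  \<comment> \<open>Starting at \<open>s + \<delta>\<close> leaves out the trivial zero
    \<open>s\<close> and keeps \<open>K\<close> compact.\<close>
  define K where "K = {x \<in> {0..\<mu>} \<times> {s + \<delta>..s + 1}. (\<lambda>(\<nu>, t). U2 \<nu> t) x = 0}"
  have K: "(\<nu>, t) \<in> K \<longleftrightarrow> 0 \<le> \<nu> \<and> \<nu> \<le> \<mu> \<and> s + \<delta> \<le> t \<and> t \<le> s + 1 \<and> U2 \<nu> t = 0" for \<nu> t
    by (auto simp: K_def)
  have "K = ({0..\<mu>} \<times> {s + \<delta>..s + 1}) \<inter> (\<lambda>(\<nu>, t). U2 \<nu> t) -` {0}"
    by (auto simp: K_def)
  moreover have "closed ((\<lambda>(\<nu>, t). U2 \<nu> t) -` {0})"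
    by (rule continuous_closed_vimage[OF closed_singleton])
      (use cont(2) continuous_on_eq_continuous_at[OF open_UNIV] in blast)
  ultimately have "compact K"
    by (simp add: compact_Int_closed compact_Times)
  have "\<not> \<tau> \<le> s + \<delta>"
    using \<delta>(3)[OF _ order_refl assms(2)] assms(1,4) by (metis less_irrefl less_imp_le)
  then have "s + \<delta> < \<tau>" by simp
  then have \<tau>: "(\<mu>, \<tau>) \<in> K" using assms by (simp add: K)
  obtain \<nu> t where \<nu>: "(\<nu>, t) \<in> K" and min: "\<And>\<nu>' t'. (\<nu>', t') \<in> K \<Longrightarrow> \<nu> \<le> \<nu>'"
  proof -
    have "continuous_on K fst" by (intro continuous_intros)
    then show ?thesis
      using continuous_attains_inf[OF \<open>compact K\<close>, of fst] \<tau> that by fastforce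
  qed
  have "s < t" "U2 \<nu> t = 0" using \<nu> \<delta>(1) by (auto simp: K)
  \<comment> \<open>\<open>W2 0\<close> is an exponential, so \<open>U2 0\<close> has no zero after
    \<open>s\<close>. Hence the minimal parameter is positive and can still be lowered.\<close>
  moreover have "0 < U2 0 t" if "s < t"
    by (rule dirac_system_pos[OF sys2 init(3) that _ h_pos]) (simp add: parameter_0)
  ultimately have "\<nu> \<noteq> 0" by auto
  then have "0 < \<nu>" using \<nu> by (simp add: K)
  have last: "t' = s + 1" if "(\<nu>, t') \<in> K" for t'
  proof (rule ccontr)
    assume "t' \<noteq> s + 1"
    with that have t': "t' < s + 1" "U2 \<nu> t' = 0" "\<nu> \<le> \<mu>" "s + \<delta> \<le> t'" by (auto simp: K)
    then have "s + \<delta> < t'" using \<delta>(1) \<delta>(3)[of \<nu> t'] \<open>0 < \<nu>\<close> by (cases "t' = s + \<delta>") auto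
    \<comment> \<open>By the Wronskian \<open>U2\<close> and \<open>W2\<close> have no common zero,
      so the zero is simple.\<close>
    have "W2 \<nu> t' \<noteq> 0" using wronskian[of \<nu> t'] t'(2) by auto
    then have "2 * pi * of_int l * U2 \<nu> t' + h t' ^ 2 * W2 \<nu> t' \<noteq> 0"
      using t'(2) h_pos[of t'] by simp
    \<comment> \<open>This radius keeps \<open>y\<close> and \<open>z\<close> between
      \<open>s + \<delta>\<close> and \<open>s + 1\<close>, so the zero found between them belongs
      to \<open>K\<close>.\<close>
    then obtain y z where yz: "t' - min (t' - (s + \<delta>)) (s + 1 - t') < y" "y < t'" "t' < z"
      "z < t' + min (t' - (s + \<delta>)) (s + 1 - t')" "U2 \<nu> y * U2 \<nu> z < 0"
      using ex_sign_change_of_deriv_neq_0[OF deriv_U2 t'(2), of "min (t' - (s + \<delta>)) (s + 1 - t')"]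
        \<open>s + \<delta> < t'\<close> t'(1) by auto
    have "isCont (\<lambda>\<nu>. U2 \<nu> y * U2 \<nu> z) \<nu>"
      using continuous_parameter(2) by (auto simp: continuous_on_eq_continuous_at)
    then have "eventually (\<lambda>\<nu>. U2 \<nu> y * U2 \<nu> z < 0) (at \<nu>)"
      using yz(5) order_tendstoD(2) unfolding isCont_def by blast
    then obtain e where e: "0 < e" "\<And>\<nu>'. \<nu>' \<noteq> \<nu> \<Longrightarrow> dist \<nu>' \<nu> < e \<Longrightarrow> U2 \<nu>' y * U2 \<nu>' z < 0"
      unfolding eventually_at by auto
    \<comment> \<open>Smaller than \<nu>, yet nonnegative and close enough for the sign change to
      persist.\<close>
    define \<nu>' where "\<nu>' = \<nu> - min e \<nu> / 2"
    have "0 < min e \<nu>" "min e \<nu> \<le> e" "min e \<nu> \<le> \<nu>" using e(1) \<open>0 < \<nu>\<close> by simp_all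
    then have \<nu>': "0 \<le> \<nu>'" "\<nu>' < \<nu>" "dist \<nu>' \<nu> < e"
      unfolding \<nu>'_def dist_real_def by linarith+
    then have "U2 \<nu>' y * U2 \<nu>' z < 0" using e(2) by simp
    then obtain r where "y < r" "r < z" "U2 \<nu>' r = 0"
      using IVT_sign_change[of y z "U2 \<nu>'"] yz continuous_time by auto
    then have "(\<nu>', r) \<in> K" using \<nu>' yz t' unfolding K by auto
    then show False using min \<nu>'(2) by fastforce
  qed
  \<comment> \<open>Here \<open>\<tau> < s + 1\<close> enters: if \<nu> were \<mu>, then
    \<open>last\<close> would force \<tau> to be \<open>s + 1\<close>.\<close>
  have "\<nu> < \<mu>"
    using last[of \<tau>] \<tau> \<nu> assms(3) by (cases "\<nu> = \<mu>") (auto simp: K)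
  moreover have "monodromy_trace \<nu> < 0"
  proof (rule trace_neg_at_first_zero[of "s + \<delta>"])
    show "s + \<delta> < s + 1" using \<delta>(2) by simp
    show "U2 \<nu> (s + 1) = 0" using last[OF \<nu>] \<nu> by (simp add: K)
    fix r assume r: "s + \<delta> \<le> r" "r < s + 1"
    show "0 < U2 \<nu> r"
    proof (rule ccontr)
      assume neg: "\<not> 0 < U2 \<nu> r"
      have "0 < U2 \<nu> (s + \<delta>)" using \<delta> \<open>0 < \<nu>\<close> \<nu> by (simp add: K)
      then obtain x where "s + \<delta> \<le> x" "x \<le> r" "U2 \<nu> x = 0"
        using IVT2'[of "U2 \<nu>" r 0 "s + \<delta>"] neg r(1) continuous_time by auto
      then show False using last[of x] \<nu> r(2) by (auto simp: K)
    qed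
  qed
  ultimately show ?thesis using that[of \<nu>] \<open>0 < \<nu>\<close> by simp
qed

lemma periodic_solution_below:
  fixes u w :: "real \<Rightarrow> real"
  assumes per: "periodic_dirac_system h l \<mu> u w" and "u s = 0" "u t \<noteq> 0" "l \<noteq> 0"
  obtains \<nu> u' w' where "\<nu> < \<mu>" "periodic_dirac_system h l \<nu> u' w'" "u' s \<noteq> 0 \<or> w' s \<noteq> (0 :: real)"
proof -
  have sys: "dirac_system h l \<mu> u w" and p: "u (s + 1) = u s" "w (s + 1) = w s"
    using per by (auto simp: periodic_dirac_system_def)
  have "0 < \<mu>"
    using periodic_dirac_system_nonpos[OF per _ \<open>l \<noteq> 0\<close> h_pos, of t] assms(3) by fastforce
  have u: "u r = w s * U2 \<mu> r" and w: "w r = w s * W2 \<mu> r" for r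
    using dirac_system_unique[OF sys sys1 sys2 init, of r] assms(2) by simp_all
  have "w s \<noteq> 0" using u[of t] assms(3) by auto
  \<comment> \<open>The data (0, 1) return to themselves after one period; with determinant 1 the
    other diagonal entry is 1 too, which gives trace 2 below.\<close>
  then have 1: "U2 \<mu> (s + 1) = 0" "W2 \<mu> (s + 1) = 1"
    using u[of "s + 1"] w[of "s + 1"] p assms(2) by auto
  have "\<exists>\<tau>. s < \<tau> \<and> \<tau> < s + 1 \<and> U2 \<mu> \<tau> = 0"
  proof (rule ccontr)
    assume no: "\<not> ?thesis"
    obtain \<delta> where \<delta>: "0 < \<delta>" "\<delta> < 1" "0 < U2 \<mu> (s + \<delta>)"
      using ex_positive_initial_interval[of \<mu>] \<open>0 < \<mu>\<close> by (metis less_add_same_cancel1 less_imp_le order_refl)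
    have "0 < U2 \<mu> r" if r: "s + \<delta> \<le> r" "r < s + 1" for r
    proof (rule ccontr)
      assume "\<not> 0 < U2 \<mu> r"
      then obtain x where "s + \<delta> \<le> x" "x \<le> r" "U2 \<mu> x = 0"
        using IVT2'[of "U2 \<mu>" r 0 "s + \<delta>"] \<delta>(3) r(1) continuous_time by auto
      then show False using no r(2) \<delta>(1) by auto
    qed
    then have "monodromy_trace \<mu> < 0"
      using trace_neg_at_first_zero[of "s + \<delta>" \<mu>] 1(1) \<delta>(2) by auto
    moreover have "monodromy_trace \<mu> = 2"
      using wronskian[of \<mu> "s + 1"] 1 by (simp add: monodromy_trace_def)
    ultimately show False by simp
  qed
  then obtain \<nu> where \<nu>: "0 \<le> \<nu>" "\<nu> < \<mu>" "monodromy_trace \<nu> < 0"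
    using ex_trace_neg[OF \<open>0 < \<mu>\<close>] by metis
  have "continuous_on {0..\<nu>} monodromy_trace"
    unfolding monodromy_trace_def
    by (intro continuous_on_add continuous_on_subset[OF continuous_parameter(1)]
        continuous_on_subset[OF continuous_parameter(3)]) auto
  then obtain \<nu>' where "0 \<le> \<nu>'" "\<nu>' \<le> \<nu>" "monodromy_trace \<nu>' = 2"
    using IVT2'[of monodromy_trace \<nu> 2 0] trace_parameter_0[OF \<open>l \<noteq> 0\<close>] \<nu> by auto
  then show ?thesis
    using periodic_solution_if_trace_eq_2[of \<nu>'] that \<nu>(2) by (metis order_le_less_trans)
qed

end

section \<open>Eigenspinors for the first eigenvalue\<close>

lemma periodic_dirac_system_Re_Im:
  assumes "periodic_dirac_system h l \<nu> u w"
  shows "periodic_dirac_system h l \<nu> (\<lambda>t. Re (u t)) (\<lambda>t. Re (w t))"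
    and "periodic_dirac_system h l \<nu> (\<lambda>t. Im (u t)) (\<lambda>t. Im (w t))"
  using assms dirac_system_bounded_linear[OF bounded_linear_Re] dirac_system_bounded_linear[OF bounded_linear_Im]
  by (auto simp: periodic_dirac_system_def)

context
  fixes h :: "real \<Rightarrow> real" and l :: int
  assumes h: "conformal_factor h" and l: "l \<noteq> 0"
begin

lemma periodic_dirac_system_imp_occurs:
  fixes u w :: "real \<Rightarrow> real"
  assumes per: "periodic_dirac_system h l \<nu> u w" and "u s \<noteq> 0 \<or> w s \<noteq> 0"
  shows "occurs l (eigenspace_plus h \<nu>)"
proof -
  \<comment> \<open>Only \<open>u\<close> enters the spinor. If it vanished identically, its
    derivative h^2 w at \<open>s\<close> would be 0, and both initial values would vanish.\<close>
  have "\<exists>t. u t \<noteq> 0"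
  proof (rule ccontr)
    assume "\<nexists>t. u t \<noteq> 0"
    then have "u = (\<lambda>_. 0)" by auto
    moreover have "(u has_real_derivative 2 * pi * of_int l * u s + h s ^ 2 * w s) (at s)"
      using per by (simp add: periodic_dirac_system_def dirac_system_real)
    ultimately have "h s ^ 2 * w s = 0" using DERIV_unique[OF _ DERIV_const] by fastforce
    then show False using assms(2) \<open>u = (\<lambda>_. 0)\<close> conformal_factor_pos[OF h, of s] by simp
  qed
  then obtain t where "u t \<noteq> 0" by blast
  then have "weight_spinor 2 l (\<lambda>t. (1 / h t) *\<^sub>R of_real (u t)) (t, 0) $ 2 \<noteq> 0"
    using conformal_factor_pos[OF h, of t] by (simp add: weight_spinor_def)
  then have "weight_spinor 2 l (\<lambda>t. (1 / h t) *\<^sub>R of_real (u t)) \<noteq> 0" by auto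
  then show ?thesis
    using periodic_dirac_system_imp_isotypic[OF h per] unfolding occurs_def by blast
qed

context
  fixes \<mu> :: real
  assumes first: "is_first_eigenvalue h l \<mu>"
begin

lemma real_periodic_solution_vanishing:
  fixes u w :: "real \<Rightarrow> real"
  assumes "periodic_dirac_system h l \<mu> u w" "u s = 0"
  shows "u t = 0"
proof (rule ccontr)
  assume "u t \<noteq> 0"
  have h_cont: "continuous_on UNIV h" using C_n_conformal_factor[OF h, of 0] by simp
  \<comment> \<open>Based at the assumed zero \<open>s\<close>, so that \<open>u\<close> is a
    multiple of \<open>U2 \<mu>\<close>.\<close>
  obtain U1 W1 U2 W2 where "fundamental_system h l s U1 W1 U2 W2"
    using ex_fundamental_system[OF h_cont, of l s] conformal_factor_pos[OF h]
      conformal_factor_periodic[OF h] unfolding fundamental_system_def by metis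
  then interpret fundamental_system h l s U1 W1 U2 W2 .
  obtain \<nu> and u' w' :: "real \<Rightarrow> real" where "\<nu> < \<mu>" "periodic_dirac_system h l \<nu> u' w'" "u' s \<noteq> 0 \<or> w' s \<noteq> 0"
    using periodic_solution_below[OF assms \<open>u t \<noteq> 0\<close> l] by metis
  then show False
    using periodic_dirac_system_imp_occurs[of \<nu> u' w' s] first unfolding is_first_eigenvalue_def by fastforce
qed

lemma complex_periodic_solution_vanishing:
  fixes u w :: "real \<Rightarrow> complex"
  assumes "periodic_dirac_system h l \<mu> u w" "u s = 0"
  shows "u t = 0"
  using real_periodic_solution_vanishing[OF periodic_dirac_system_Re_Im(1)[OF assms(1)], of s t]
    real_periodic_solution_vanishing[OF periodic_dirac_system_Re_Im(2)[OF assms(1)], of s t] assms(2)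
  by (simp add: complex_eq_iff)

lemma eigenspinor_nonvanishing:
  assumes "\<psi> \<in> isotypic l (eigenspace_plus h \<mu>)" "\<psi> \<noteq> 0"
  shows "\<psi> p \<noteq> 0"
proof
  assume "\<psi> p = 0"
  obtain s y where p: "p = (s, y)" by fastforce
  obtain u w :: "real \<Rightarrow> complex" where uw: "periodic_dirac_system h l \<mu> u w"
    "\<psi> = weight_spinor 2 l (\<lambda>t. (1 / h t) *\<^sub>R u t)"
    using isotypic_eigenspace_plusE[OF h assms(1)] by metis
  have "u s = 0"
    using \<open>\<psi> p = 0\<close> conformal_factor_pos[OF h, of s] unfolding uw(2) p by (simp add: weight_spinor_def)
  then have "u t = 0" for t
    using complex_periodic_solution_vanishing[OF uw(1)] by blast
  then have "\<psi> = 0" unfolding uw(2) by (auto simp: weight_spinor_def fun_eq_iff)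
  then show False using assms(2) by simp
qed

lemma eigenspinor_proportional:
  assumes \<psi>: "\<psi> \<in> isotypic l (eigenspace_plus h \<mu>)" "\<psi> \<noteq> 0" and \<phi>: "\<phi> \<in> isotypic l (eigenspace_plus h \<mu>)"
  shows "\<exists>c. \<phi> = spinor_scale c \<psi>"
proof -
  obtain u w :: "real \<Rightarrow> complex" where uw: "periodic_dirac_system h l \<mu> u w"
    "\<psi> = weight_spinor 2 l (\<lambda>t. (1 / h t) *\<^sub>R u t)"
    using isotypic_eigenspace_plusE[OF h \<psi>(1)] by metis
  obtain v z :: "real \<Rightarrow> complex" where vz: "periodic_dirac_system h l \<mu> v z"
    "\<phi> = weight_spinor 2 l (\<lambda>t. (1 / h t) *\<^sub>R v t)"
    using isotypic_eigenspace_plusE[OF h \<phi>] by metis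
  have "u 0 \<noteq> 0"
    using eigenspinor_nonvanishing[OF \<psi>, of "(0, 0)"] by (auto simp: uw(2) weight_spinor_def)
  \<comment> \<open>Makes \<open>v - c * u\<close> vanish at 0, hence everywhere.\<close>
  define c where "c = v 0 / u 0"
  have "periodic_dirac_system h l \<mu> (\<lambda>t. 1 * v t + (- c) * u t) (\<lambda>t. 1 * z t + (- c) * w t)"
    using uw(1) vz(1) dirac_system_linear_combination[of h l \<mu> v z u w 1 "- c"]
    unfolding periodic_dirac_system_def by simp
  then have "1 * v t + (- c) * u t = 0" for t
    by (rule complex_periodic_solution_vanishing[where s = 0]) (use \<open>u 0 \<noteq> 0\<close> in \<open>simp add: c_def\<close>)
  then have "v t = c * u t" for t
    by simp
  then have "\<phi> = spinor_scale c \<psi>"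
    unfolding uw(2) vz(2) by (auto simp: weight_spinor_def spinor_scale_def fun_eq_iff vec_eq_iff axis_def)
  then show ?thesis ..
qed

end

end

theorem mainTheorem7:
  fixes h :: "real \<Rightarrow> real" and l :: int and \<mu> :: real
  assumes "conformal_factor h"
    and "l \<noteq> 0"
    and "is_first_eigenvalue h l \<mu>"
  shows "weight_multiplicity l (eigenspace_plus h \<mu>) = 1 \<and>
    (\<forall>\<psi> \<in> isotypic l (eigenspace_plus h \<mu>). \<psi> \<noteq> 0 \<longrightarrow> (\<forall>p. \<psi> p \<noteq> 0))"
proof
  obtain \<psi> where \<psi>: "\<psi> \<in> isotypic l (eigenspace_plus h \<mu>)" "\<psi> \<noteq> 0"
    using assms(3) unfolding is_first_eigenvalue_def occurs_def by blast
  have "isotypic l (eigenspace_plus h \<mu>) \<subseteq> spinor.span {\<psi>}"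
    using eigenspinor_proportional[OF assms \<psi>] unfolding spinor.span_singleton by blast
  then show "weight_multiplicity l (eigenspace_plus h \<mu>) = 1"
    unfolding weight_multiplicity_def
    using \<psi> by (intro spinor.dim_unique[of "{\<psi>}"]) auto
  show "\<forall>\<psi> \<in> isotypic l (eigenspace_plus h \<mu>). \<psi> \<noteq> 0 \<longrightarrow> (\<forall>p. \<psi> p \<noteq> 0)"
    using eigenspinor_nonvanishing[OF assms] by blast
qed

end
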